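(* Suppose that (1) $\theta\mapsto P_\theta(A)$ is measurable for every $A\in\mathcal{A}$, and (2) for all $\theta,\theta'\in\Theta$, $\theta\neq\theta'$ implies $P_\theta\neq P_{\theta'}$. Then there exists $\Theta_1\subseteq\Theta$ with $\Pi(\Theta_1)=1$ such that the posterior is consistent at every $\theta_1\in\Theta_1$. That is, for all $\theta_1\in\Theta_1$, if $X_1,X_2,\dots\sim P_{\theta_1}$ i.i.d., then for any neighborhood $B$ of $\theta_1$, we have $$\lim_{n\to\infty}\mathbb{P}\bigl(\boldsymbol{\theta}\in B\mid X_1,\dots,X_n\bigr)=1\quad\text{a.s.}[P_{\theta_1}],$$ where $\mathbb{P}(\boldsymbol{\theta}\in B\mid X_1,\dots,X_n)=\mathbb{E}(I_B(\boldsymbol{\theta})\mid X_1,\dots,X_n)$ is computed under $\mu$.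
   Context: Let $\widehat{\mathcal{X}}$ and $\widehat\Theta$ be complete separable metric spaces. Let $\mathcal{X}\subseteq\widehat{\mathcal{X}}$ and $\Theta\subseteq\widehat\Theta$ be Borel measurable subsets, and let $\mathcal{A}$ and $\mathcal{B}$ be the induced Borel $\sigma$-algebras of $\mathcal{X}$ and $\Theta$, respectively. For each $\theta\in\Theta$, let $P_\theta$ be a probability measure on $(\mathcal{X},\mathcal{A})$. Let $\Pi$ be a probability measure on $(\Theta,\mathcal{B})$. Neighborhoods are taken in $\Theta$ with its metric topology. The symbol $\theta$ denotes fixed values in $\Theta$ and $\boldsymbol{\theta}$ a random variable taking values in $\Theta$. The joint distribution $\mu$ of $((X_1,X_2,\dots),\boldsymbol{\theta})$ is defined by letting $\boldsymbol{\theta}\sim\Pi$ and $X_1,X_2,\dots\mid\boldsymbol{\theta}$ i.i.d. $\sim P_{\boldsymbol{\theta}}$. Equivalently, let $\mathcal{X}^\infty=\mathcal{X}\times\mathcal{X}\times\cdots$ with product $\sigma$-algebra $\mathcal{A}^\infty$, and let $P_\theta^\infty$ be the infinite product probability measure on $(\mathcal{X}^\infty,\mathcal{A}^\infty)$ obtained from $P_\theta$; then $\mu$ is the probability measure on $(\mathcal{X}^\infty\times\Theta,\mathcal{A}^\infty\otimes\mathcal{B})$ given by $\mu(E)=\int_\Theta P_\theta^\infty(E_\theta)\,d\Pi(\theta)$, where $E_\theta=\{x\in\mathcal{X}^\infty:(x,\theta)\in E\}$ (this is well-defined when condition (1) holds). $I_B$ is the indicator function of $B$. The notation a.s.$[P_{\theta_1}]$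 means almost surely when $X_1,X_2,\dots$ are i.i.d. from $P_{\theta_1}$, i.e. when $(X_1,X_2,\dots)$ has distribution $P_{\theta_1}^\infty$. *)

theory Defs
  imports "HOL-Probability.Probability"
begin

text \<open>
  The complete separable metric spaces are the types \<open>'a\<close> (observations) and \<open>'b\<close> (parameters) of
  class \<open>polish_space\<close>; \<open>X\<close> and \<open>\<Theta>\<close> are Borel subsets of them. The observations are indexed from
  \<open>0\<close>, so the first \<open>n\<close> of them are the coordinates in \<open>{..<n}\<close>.
\<close>

abbreviation borel_on :: "'a::topological_space set \<Rightarrow> 'a measure" where
  "borel_on S \<equiv> restrict_space borel S"

definition joint_space ::
  "'a::polish_space set \<Rightarrow> 'b::polish_space set \<Rightarrow> ((nat \<Rightarrow> 'a) \<times> 'b) measure" where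
  "joint_space X \<Theta> = (\<Pi>\<^sub>M i\<in>UNIV. borel_on X) \<Otimes>\<^sub>M borel_on \<Theta>"

text \<open>
  For measurable \<open>E\<close>, the preimage of \<open>E\<close> under \<open>\<lambda>x. (x, t)\<close> is the section of \<open>E\<close> at \<open>t\<close>.
\<close>
definition joint_measure ::
  "'a::polish_space set \<Rightarrow> 'b::polish_space set \<Rightarrow> ('b \<Rightarrow> 'a measure) \<Rightarrow> 'b measure
    \<Rightarrow> ((nat \<Rightarrow> 'a) \<times> 'b) measure" where
  "joint_measure X \<Theta> P prior =
     measure_of (space (joint_space X \<Theta>)) (sets (joint_space X \<Theta>))
       (\<lambda>E. \<integral>\<^sup>+ t. emeasure (\<Pi>\<^sub>M i\<in>UNIV. P t) ((\<lambda>x. (x, t)) -` E) \<partial>prior)"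

definition first_obs :: "nat \<Rightarrow> (nat \<Rightarrow> 'a) \<Rightarrow> nat \<Rightarrow> 'a" where
  "first_obs n x = restrict x {..<n}"

text \<open>The \<open>\<sigma>\<close>-algebra on the joint space generated by the first \<open>n\<close> observations.\<close>
definition obs_algebra ::
  "'a::polish_space set \<Rightarrow> 'b::polish_space set \<Rightarrow> nat \<Rightarrow> ((nat \<Rightarrow> 'a) \<times> 'b) measure" where
  "obs_algebra X \<Theta> n =
     vimage_algebra (space (joint_space X \<Theta>)) (\<lambda>\<omega>. first_obs n (fst \<omega>))
       (\<Pi>\<^sub>M i\<in>{..<n}. borel_on X)"

text \<open>
  A posterior: for each \<open>n\<close>, a regular version of the conditional probabilities of events
  \<open>\<theta> \<in> B\<close> given the first \<open>n\<close> observations, i.e. a probability kernel that, for each fixed \<open>B\<close>,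
  is almost surely equal to the conditional expectation of the indicator of \<open>\<theta> \<in> B\<close>. Regularity
  matters because a conditional expectation is determined only up to a null set that may depend
  on \<open>B\<close>, while consistency ranges over uncountably many \<open>B\<close>.
\<close>
definition is_posterior ::
  "'a::polish_space set \<Rightarrow> 'b::polish_space set \<Rightarrow> ('b \<Rightarrow> 'a measure) \<Rightarrow> 'b measure
    \<Rightarrow> (nat \<Rightarrow> (nat \<Rightarrow> 'a) \<Rightarrow> 'b measure) \<Rightarrow> bool" where
  "is_posterior X \<Theta> P prior post \<longleftrightarrow>
     (\<forall>n. post n \<in> (\<Pi>\<^sub>M i\<in>{..<n}. borel_on X) \<rightarrow>\<^sub>M prob_algebra (borel_on \<Theta>) \<and>
       (\<forall>B\<in>sets (borel_on \<Theta>).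
          AE \<omega> in joint_measure X \<Theta> P prior.
            measure (post n (first_obs n (fst \<omega>))) B =
            real_cond_exp (joint_measure X \<Theta> P prior) (obs_algebra X \<Theta> n)
              (\<lambda>\<omega>. indicator B (snd \<omega>)) \<omega>))"

text \<open>
  Neighborhoods are taken in the subspace \<open>\<Theta>\<close>; they need not be open, but they are measurable, so
  that the event \<open>\<theta> \<in> B\<close> has a conditional probability.
\<close>
definition consistent_at ::
  "'b::polish_space set \<Rightarrow> ('b \<Rightarrow> 'a::polish_space measure)
    \<Rightarrow> (nat \<Rightarrow> (nat \<Rightarrow> 'a) \<Rightarrow> 'b measure) \<Rightarrow> 'b \<Rightarrow> bool" where
  "consistent_at \<Theta> P post \<theta>\<^sub>1 \<longleftrightarrow>
     (\<forall>B\<in>sets (borel_on \<Theta>). \<theta>\<^sub>1 \<in> top_of_set \<Theta> interior_of B \<longrightarrow>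
        (AE x in (\<Pi>\<^sub>M i\<in>(UNIV :: nat set). P \<theta>\<^sub>1).
           (\<lambda>n. measure (post n (first_obs n x)) B) \<longlonglongrightarrow> 1))"

end

theory Submission
  imports Defs
begin

text \<open>
  Doob's consistency theorem. Let \<open>\<mu>\<close> be the joint law of the observations and the parameter, and
  \<open>F n\<close> the \<open>\<sigma>\<close>-algebra of the first \<open>n\<close> observations. For measurable \<open>B\<close>, the posterior
  probabilities of \<open>B\<close> form the martingale of conditional probabilities of \<open>\<theta> \<in> B\<close> given \<open>F n\<close>.
  They converge almost surely to the indicator of \<open>\<theta> \<in> B\<close> as soon as this event is determined by
  the whole sequence of observations up to a null set (\<open>levy_zero_one\<close>).

  That it is so determined is \<open>parameter_limit_event\<close>. The empirical frequency of a set \<open>A\<close> converges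
  in probability to \<open>P \<theta> A\<close>, so the sequence determines every event \<open>P \<theta> A > q\<close>. Countably many of
  these events separate the parameters, because \<open>\<theta> \<mapsto> P \<theta>\<close> is injective; hence some injective Borel
  function \<open>f\<close> of the parameter is determined. It remains to recover \<open>\<theta>\<close> from \<open>f \<theta>\<close> measurably.
  For conditional probabilities an almost sure recovery is enough, and this follows from Lusin's
  theorem: up to small measure \<open>f\<close> is continuous on a compact set, and there an injective function
  has a continuous inverse (\<open>measurable_left_inverse\<close>).

  Applied to a countable base of the topology of \<open>\<Theta>\<close>, this gives one \<open>\<mu>\<close>-null set outside of which
  all posterior probabilities of base sets converge. By the mixture form of \<open>\<mu>\<close>, for almost every
  \<open>\<theta>\<close> the convergence holds almost surely when the observations come from \<open>P \<theta>\<close>. A neighborhood of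
  \<open>\<theta>\<close> contains a base set around \<open>\<theta>\<close>, whose posterior probability tends to \<open>1\<close>.

  A posterior exists because regular conditional distributions exist on Borel subsets of Polish
  spaces (\<open>regular_conditional_distribution\<close>). On the unit interval they are built from conditional
  distribution functions, and an injective code of the points by numbers, together with its almost
  sure left inverse, carries the construction over to \<open>\<Theta>\<close>.
\<close>

section \<open>Levy's upward theorem\<close>

text \<open>
  Doob's maximal inequality for the martingale closed by \<open>h\<close>. On the event that the martingale first
  exceeds \<open>l\<close> at time \<open>n\<close>, which lies in \<open>F n\<close>, the integrals of \<open>h\<close> and of its conditional
  expectation agree, and the latter is at least \<open>l\<close> times the probability. These events are disjoint.
\<close>
lemma (in prob_space) cond_exp_maximal_inequality:
  fixes F :: "nat \<Rightarrow> 'a measure" and h :: "'a \<Rightarrow> real"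
  assumes sub: "\<And>n. subalgebra M (F n)"
    and mono: "\<And>m n. m \<le> n \<Longrightarrow> sets (F m) \<subseteq> sets (F n)"
    and h: "integrable M h" "\<And>\<omega>. 0 \<le> h \<omega>" and l: "0 < l"
  shows "prob {\<omega> \<in> space M. \<exists>n. l < real_cond_exp M (F n) h \<omega>} \<le> (\<integral>\<omega>. h \<omega> \<partial>M) / l"
proof -
  define q where "q n = real_cond_exp M (F n) h" for n
  define A where "A n = {\<omega> \<in> space M. l < q n \<omega> \<and> (\<forall>k<n. q k \<omega> \<le> l)}" for n
  have S: "finite_measure_subalgebra M (F n)" for n
    by (intro finite_measure_subalgebra.intro finite_measure_subalgebra_axioms.intro sub)
       unfold_locales
  have AF: "A n \<in> sets (F n)" for n
  proof -
    have sp: "space (F k) = space M" for k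
      using sub[of k] by (simp add: subalgebra_def)
    have q: "q k \<in> borel_measurable (F n)" if "k \<le> n" for k
    proof -
      have "subalgebra (F n) (F k)" using mono[OF that] sp by (simp add: subalgebra_def)
      then show ?thesis unfolding q_def by (rule measurable_from_subalg) simp
    qed
    have [measurable]: "q n \<in> borel_measurable (F n)" by (rule q) simp
    have "A n = {\<omega> \<in> space (F n). l < q n \<omega>} \<inter> (\<Inter>k\<in>{..<n}. {\<omega> \<in> space (F n). q k \<omega> \<le> l})
        \<inter> space (F n)"
      by (auto simp: A_def sp)
    moreover have "(\<Inter>k\<in>{..<n}. {\<omega> \<in> space (F n). q k \<omega> \<le> l}) \<inter> space (F n) \<in> sets (F n)"
    proof -
      have "(\<Inter>k\<in>{..<n}. {\<omega> \<in> space (F n). q k \<omega> \<le> l}) \<inter> space (F n)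
          = {\<omega> \<in> space (F n). \<forall>k\<in>{..<n}. q k \<omega> \<le> l}" by auto
      also have "\<dots> \<in> sets (F n)"
      proof (rule sets.sets_Collect_finite_All)
        fix k assume "k \<in> {..<n}"
        then have [measurable]: "q k \<in> borel_measurable (F n)" by (intro q) simp
        show "{\<omega> \<in> space (F n). q k \<omega> \<le> l} \<in> sets (F n)" by measurable
      qed simp
      finally show ?thesis .
    qed
    ultimately show ?thesis by (simp add: Int_assoc)
  qed
  have AM[measurable]: "A n \<in> sets M" for n using AF[of n] sub[of n] by (auto simp: subalgebra_def)
  have disj: "disjoint_family A"
  proof (unfold disjoint_family_on_def, intro ballI impI)
    fix i j :: nat assume "i \<noteq> j"
    then consider "i < j" | "j < i" by linarith
    then show "A i \<inter> A j = {}" by cases (fastforce simp: A_def)+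
  qed
  have step: "l * prob (A n) \<le> (\<integral>\<omega>. indicator (A n) \<omega> * h \<omega> \<partial>M)" for n
  proof -
    interpret G: finite_measure_subalgebra M "F n" by (rule S)
    have iq: "integrable M (q n)" unfolding q_def by (rule G.real_cond_exp_int(1)[OF h(1)])
    have "l * prob (A n) = (\<integral>\<omega>. indicator (A n) \<omega> * l \<partial>M)" by simp
    also have "\<dots> \<le> (\<integral>\<omega>. indicator (A n) \<omega> * q n \<omega> \<partial>M)"
    proof (rule integral_mono)
      show "integrable M (\<lambda>\<omega>. indicator (A n) \<omega> * q n \<omega>)"
        using integrable_mult_indicator[OF AM iq] by simp
      show "indicator (A n) \<omega> * l \<le> indicator (A n) \<omega> * q n \<omega>" for \<omega>
        by (auto simp: indicator_def A_def)
    qed (auto intro!: integrable_mult_left integrable_real_indicator emeasure_finite simp: less_top[symmetric])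
    also have "\<dots> = (\<integral>\<omega>. indicator (A n) \<omega> * h \<omega> \<partial>M)"
      using G.real_cond_exp_intA[OF h(1) AF] by (simp add: q_def set_lebesgue_integral_def)
    finally show ?thesis .
  qed
  have partial: "(\<Sum>n<N. prob (A n)) \<le> (\<integral>\<omega>. h \<omega> \<partial>M) / l" for N
  proof -
    have ih: "integrable M (\<lambda>\<omega>. indicator (A n) \<omega> * h \<omega>)" for n
      using integrable_mult_indicator[OF AM h(1)] by simp
    have "l * (\<Sum>n<N. prob (A n)) \<le> (\<Sum>n<N. \<integral>\<omega>. indicator (A n) \<omega> * h \<omega> \<partial>M)"
      unfolding sum_distrib_left by (rule sum_mono) (rule step)
    also have "\<dots> = (\<integral>\<omega>. (\<Sum>n<N. indicator (A n) \<omega> * h \<omega>) \<partial>M)"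
      by (subst Bochner_Integration.integral_sum) (use ih in auto)
    also have "\<dots> \<le> (\<integral>\<omega>. h \<omega> \<partial>M)"
    proof (rule integral_mono)
      show "integrable M (\<lambda>\<omega>. \<Sum>n<N. indicator (A n) \<omega> * h \<omega>)"
        by (intro Bochner_Integration.integrable_sum ih)
      fix \<omega>
      have "(\<Sum>n<N. indicator (A n) \<omega>) = (indicator (\<Union>n\<in>{..<N}. A n) \<omega> :: real)"
        by (rule indicator_UN_disjoint[symmetric])
           (use disj in \<open>auto simp: disjoint_family_on_def\<close>)
      then have "(\<Sum>n<N. indicator (A n) \<omega> * h \<omega>) = indicator (\<Union>n\<in>{..<N}. A n) \<omega> * h \<omega>"
        by (simp add: sum_distrib_right[symmetric])
      also have "\<dots> \<le> h \<omega>" using h(2)[of \<omega>] by (auto simp: indicator_def)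
      finally show "(\<Sum>n<N. indicator (A n) \<omega> * h \<omega>) \<le> h \<omega>" .
    qed (rule h)
    finally show ?thesis using l by (simp add: field_simps)
  qed
  have "(\<lambda>N. \<Sum>n<N. prob (A n)) \<longlonglongrightarrow> prob (\<Union>n. A n)"
    using finite_measure_UNION[OF _ disj] AM unfolding sums_def by blast
  then have "prob (\<Union>n. A n) \<le> (\<integral>\<omega>. h \<omega> \<partial>M) / l"
    by (rule LIMSEQ_le_const2) (use partial in auto)
  moreover have "{\<omega> \<in> space M. \<exists>n. l < q n \<omega>} = (\<Union>n. A n)"
  proof (intro equalityI subsetI)
    fix \<omega> assume "\<omega> \<in> {\<omega> \<in> space M. \<exists>n. l < q n \<omega>}"
    then have *: "\<omega> \<in> space M" "\<exists>n. l < q n \<omega>" by auto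
    define n where "n = (LEAST n. l < q n \<omega>)"
    have "l < q n \<omega>" unfolding n_def by (rule LeastI_ex) (rule *)
    moreover have "q k \<omega> \<le> l" if "k < n" for k
      using not_less_Least[of k "\<lambda>n. l < q n \<omega>"] that by (auto simp: n_def)
    ultimately show "\<omega> \<in> (\<Union>n. A n)" using * by (auto simp: A_def)
  qed (auto simp: A_def)
  ultimately show ?thesis by (simp add: q_def)
qed

text \<open>
  A function measurable for some \<open>F m\<close> is its own conditional expectation from time \<open>m\<close> on, so only
  the error \<open>h = \<bar>f - g\<bar>\<close> of an approximation \<open>g\<close> matters. The maximal inequality bounds its
  conditional expectations at all times at once, which turns approximation in mean into almost sure
  convergence.
\<close>
theorem (in prob_space) levy_upward:
  fixes F :: "nat \<Rightarrow> 'a measure" and f :: "'a \<Rightarrow> real"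
  assumes sub: "\<And>n. subalgebra M (F n)"
    and mono: "\<And>m n. m \<le> n \<Longrightarrow> sets (F m) \<subseteq> sets (F n)"
    and f: "integrable M f"
    and approx: "\<And>e. 0 < e \<Longrightarrow> \<exists>m g. g \<in> borel_measurable (F m) \<and> integrable M g \<and>
                   (\<integral>\<omega>. \<bar>f \<omega> - g \<omega>\<bar> \<partial>M) < e"
  shows "AE \<omega> in M. (\<lambda>n. real_cond_exp M (F n) f \<omega>) \<longlonglongrightarrow> f \<omega>"
proof -
  define q where "q n = real_cond_exp M (F n) f" for n
  have [measurable]: "q n \<in> borel_measurable M" for n by (simp add: q_def)
  have [measurable]: "f \<in> borel_measurable M" using f by simp
  have S: "finite_measure_subalgebra M (F n)" for n
    by (intro finite_measure_subalgebra.intro finite_measure_subalgebra_axioms.intro sub)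
       unfold_locales
  have close: "AE \<omega> in M. \<exists>N. \<forall>n\<ge>N. \<bar>q n \<omega> - f \<omega>\<bar> \<le> 2 * l" if l: "0 < l" for l
  proof -
    define Bad where "Bad = {\<omega> \<in> space M. \<not> (\<exists>N. \<forall>n\<ge>N. \<bar>q n \<omega> - f \<omega>\<bar> \<le> 2 * l)}"
    have Bad[measurable]: "Bad \<in> sets M" unfolding Bad_def by measurable
    have "prob Bad \<le> e" if e: "0 < e" for e
    proof -
      obtain m g where g: "g \<in> borel_measurable (F m)" "integrable M g"
        and fg: "(\<integral>\<omega>. \<bar>f \<omega> - g \<omega>\<bar> \<partial>M) < e * l / 2"
        using approx[of "e * l / 2"] e l by auto
      define h where "h \<omega> = \<bar>f \<omega> - g \<omega>\<bar>" for \<omega>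
      have h: "integrable M h" using f g unfolding h_def by auto
      then have [measurable]: "h \<in> borel_measurable M" by simp
      have near: "AE \<omega> in M. m \<le> n \<longrightarrow> \<bar>q n \<omega> - g \<omega>\<bar> \<le> real_cond_exp M (F n) h \<omega>" for n
      proof (cases "m \<le> n")
        case True
        interpret G: finite_measure_subalgebra M "F n" by (rule S)
        have "subalgebra (F n) (F m)"
          using mono[OF True] sub[of n] sub[of m] by (simp add: subalgebra_def)
        then have "g \<in> borel_measurable (F n)" using g(1) by (rule measurable_from_subalg)
        then have 1: "AE \<omega> in M. real_cond_exp M (F n) g \<omega> = g \<omega>" by (intro G.real_cond_exp_F_meas g)
        have 2: "AE \<omega> in M. real_cond_exp M (F n) (\<lambda>x. f x - g x) \<omega> = q n \<omega> - real_cond_exp M (F n) g \<omega>"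
          unfolding q_def by (rule G.real_cond_exp_diff[OF f g(2)])
        have 3: "AE \<omega> in M. real_cond_exp M (F n) (\<lambda>x. g x - f x) \<omega> = real_cond_exp M (F n) g \<omega> - q n \<omega>"
          unfolding q_def by (rule G.real_cond_exp_diff[OF g(2) f])
        have 4: "AE \<omega> in M. real_cond_exp M (F n) (\<lambda>x. f x - g x) \<omega> \<le> real_cond_exp M (F n) h \<omega>"
          by (rule G.real_cond_exp_mono) (use f g h in \<open>auto simp: h_def\<close>)
        have 5: "AE \<omega> in M. real_cond_exp M (F n) (\<lambda>x. g x - f x) \<omega> \<le> real_cond_exp M (F n) h \<omega>"
          by (rule G.real_cond_exp_mono) (use f g h in \<open>auto simp: h_def\<close>)
        show ?thesis using 1 2 3 4 5 by eventually_elim auto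
      qed simp
      then have near: "AE \<omega> in M. \<forall>n. m \<le> n \<longrightarrow> \<bar>q n \<omega> - g \<omega>\<bar> \<le> real_cond_exp M (F n) h \<omega>"
        by (simp add: AE_all_countable)
      \<comment> \<open>If neither \<open>h\<close> nor any of its conditional expectations exceeds \<open>l\<close>, both
        \<open>f\<close> and, for \<open>n \<ge> m\<close>, \<open>q n\<close> are within \<open>l\<close> of \<open>g\<close>.\<close>
      let ?A = "{\<omega> \<in> space M. \<exists>n. l < real_cond_exp M (F n) h \<omega>}"
      let ?B = "{\<omega> \<in> space M. l \<le> h \<omega>}"
      have "prob Bad \<le> prob (?A \<union> ?B)"
      proof (rule finite_measure_mono_AE)
        show "AE \<omega> in M. \<omega> \<in> Bad \<longrightarrow> \<omega> \<in> ?A \<union> ?B"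
          using near
        proof eventually_elim
          case (elim \<omega>)
          show ?case
          proof (rule impI, rule ccontr)
            assume b: "\<omega> \<in> Bad" "\<omega> \<notin> ?A \<union> ?B"
            then have small: "\<forall>n. real_cond_exp M (F n) h \<omega> \<le> l" "h \<omega> \<le> l"
              by (auto simp: Bad_def not_less not_le)
            then have "\<bar>q n \<omega> - f \<omega>\<bar> \<le> 2 * l" if "m \<le> n" for n
              using elim[rule_format, OF that] spec[OF small(1), of n] small(2) unfolding h_def by linarith
            with b show False by (auto simp: Bad_def)
          qed
        qed
      qed measurable
      also have "\<dots> \<le> prob ?A + prob ?B" by (rule measure_Un_le) measurable
      also have "prob ?A \<le> (\<integral>\<omega>. h \<omega> \<partial>M) / l"
        by (rule cond_exp_maximal_inequality[OF sub mono h _ l]) (auto simp: h_def)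
      also have "prob ?B \<le> (\<integral>\<omega>. h \<omega> \<partial>M) / l"
        using integral_Markov_inequality_measure[OF h, of "{}" l] l by (simp add: h_def)
      also have "(\<integral>\<omega>. h \<omega> \<partial>M) / l + (\<integral>\<omega>. h \<omega> \<partial>M) / l \<le> e"
        using fg l by (simp add: h_def field_simps)
      finally show ?thesis by simp
    qed
    then have "prob Bad \<le> 0" by (rule field_le_epsilon[where y = 0, simplified])
    then have "prob Bad = 0" by (simp add: measure_le_0_iff)
    then have "AE \<omega> in M. \<omega> \<notin> Bad"
      using Bad by (intro AE_not_in) (simp add: null_sets_def emeasure_eq_measure)
    then show ?thesis using AE_space by eventually_elim (auto simp: Bad_def)
  qed
  have "AE \<omega> in M. \<forall>k. \<exists>N. \<forall>n\<ge>N. \<bar>q n \<omega> - f \<omega>\<bar> \<le> 2 * (1 / Suc k)"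
    unfolding AE_all_countable by (intro allI close) simp
  then show ?thesis
  proof eventually_elim
    case (elim \<omega>)
    show ?case unfolding q_def[symmetric]
    proof (rule LIMSEQ_I)
      fix r :: real assume "0 < r"
      then obtain k where k: "1 / Suc k < r / 2" using nat_approx_posE[of "r/2"] by auto
      with elim obtain N where "\<forall>n\<ge>N. \<bar>q n \<omega> - f \<omega>\<bar> \<le> 2 * (1 / Suc k)" by blast
      then show "\<exists>N. \<forall>n\<ge>N. norm (q n \<omega> - f \<omega>) < r" using k by (intro exI[of _ N]) (auto intro: le_less_trans)
    qed
  qed
qed

section \<open>Events determined in the limit of a filtration\<close>

text \<open>
  For an increasing sequence \<open>F\<close> these are the events that belong, up to a null set, to the
  \<open>\<sigma>\<close>-algebra generated by all \<open>F n\<close>. They are described by approximation,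
  the form in which Levy's theorem uses them and convergence in probability provides them.
\<close>
definition limit_events :: "'a measure \<Rightarrow> (nat \<Rightarrow> 'a measure) \<Rightarrow> 'a set set" where
  "limit_events M F = {E \<in> sets M. \<forall>e>0. \<exists>m. \<exists>G\<in>sets (F m). measure M (sym_diff E G) < e}"

text \<open>
  For a countable union, a finite part approximates the whole by continuity of the measure, and the
  finite part is approximated within \<open>F m\<close> for the largest of the finitely many times involved.
\<close>
lemma (in prob_space) sigma_algebra_limit_events:
  assumes sub: "\<And>n. subalgebra M (F n)"
    and mono: "\<And>m n. m \<le> n \<Longrightarrow> sets (F m) \<subseteq> sets (F n)"
  shows "sigma_algebra (space M) (limit_events M F)"
proof -
  have FM: "G \<in> sets (F m) \<Longrightarrow> G \<in> sets M" for G m using sub[of m] by (auto simp: subalgebra_def)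
  have sp: "space (F m) = space M" for m using sub[of m] by (auto simp: subalgebra_def)
  have Un: "E1 \<union> E2 \<in> limit_events M F"
    if E: "E1 \<in> limit_events M F" "E2 \<in> limit_events M F" for E1 E2
  proof -
    have "\<exists>m. \<exists>G\<in>sets (F m). measure M (sym_diff (E1 \<union> E2) G) < e" if "0 < e" for e
    proof -
      obtain m1 G1 where 1: "G1 \<in> sets (F m1)" "measure M (sym_diff E1 G1) < e / 2"
        using E(1) \<open>0 < e\<close> unfolding limit_events_def by (auto dest!: spec[of _ "e/2"])
      obtain m2 G2 where 2: "G2 \<in> sets (F m2)" "measure M (sym_diff E2 G2) < e / 2"
        using E(2) \<open>0 < e\<close> unfolding limit_events_def by (auto dest!: spec[of _ "e/2"])
      note FM[OF 1(1), measurable] FM[OF 2(1), measurable]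
      have [measurable]: "E1 \<in> sets M" "E2 \<in> sets M" using E by (auto simp: limit_events_def)
      have "G1 \<union> G2 \<in> sets (F (max m1 m2))"
        using 1(1) 2(1) mono[of m1 "max m1 m2"] mono[of m2 "max m1 m2"] by auto
      moreover have "measure M (sym_diff (E1 \<union> E2) (G1 \<union> G2))
          \<le> measure M (sym_diff E1 G1 \<union> sym_diff E2 G2)"
        by (rule finite_measure_mono) auto
      then have "measure M (sym_diff (E1 \<union> E2) (G1 \<union> G2)) < e"
        using measure_Un_le[of "sym_diff E1 G1" M "sym_diff E2 G2"] 1(2) 2(2) by auto
      ultimately show ?thesis by blast
    qed
    then show ?thesis using E by (auto simp: limit_events_def)
  qed
  show ?thesis
  proof (unfold sigma_algebra_iff2, intro conjI ballI allI impI)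
    show "limit_events M F \<subseteq> Pow (space M)"
      using sets.sets_into_space by (auto simp: limit_events_def)
    have "{} \<in> sets M \<and> (\<forall>e>0. \<exists>m. \<exists>G\<in>sets (F m). measure M (sym_diff {} G) < e)"
      by (auto intro!: bexI[of _ "{}"])
    then show empty: "{} \<in> limit_events M F" by (simp add: limit_events_def)
    show "space M - E \<in> limit_events M F" if E: "E \<in> limit_events M F" for E
    proof -
      have "\<exists>m. \<exists>G\<in>sets (F m). measure M (sym_diff (space M - E) G) < e" if "0 < e" for e
      proof -
        obtain m G where G: "G \<in> sets (F m)" "measure M (sym_diff E G) < e"
          using E \<open>0 < e\<close> unfolding limit_events_def by blast
        have "E \<subseteq> space M" using E sets.sets_into_space by (auto simp: limit_events_def)
        moreover have "G \<subseteq> space M" using FM[OF G(1)] sets.sets_into_space by auto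
        ultimately have "sym_diff (space M - E) (space M - G) = sym_diff E G" by auto
        moreover have "space M - G \<in> sets (F m)" using G(1) sp by (metis sets.compl_sets)
        ultimately show ?thesis using G by (metis (no_types, lifting))
      qed
      then show ?thesis using E by (auto simp: limit_events_def)
    qed
    fix A :: "nat \<Rightarrow> 'a set" assume A: "range A \<subseteq> limit_events M F"
    define U where "U n = (\<Union>i\<le>n. A i)" for n
    have U: "U n \<in> limit_events M F" for n
    proof (induction n)
      case 0 then show ?case using A by (auto simp: U_def)
    next
      case (Suc n)
      have "U (Suc n) = U n \<union> A (Suc n)" by (auto simp: U_def le_Suc_eq)
      then show ?case using Un[OF Suc, of "A (Suc n)"] A by auto
    qed
    have [measurable]: "A i \<in> sets M" for i using A by (auto simp: limit_events_def)
    have [measurable]: "U i \<in> sets M" for i using U by (auto simp: limit_events_def)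
    have lim: "(\<lambda>n. prob (U n)) \<longlonglongrightarrow> prob (\<Union>n. U n)"
      by (rule finite_Lim_measure_incseq) (auto simp: incseq_def U_def intro: order_trans)
    have UA: "(\<Union>n. U n) = (\<Union>n. A n)" by (auto simp: U_def)
    have "\<exists>m. \<exists>G\<in>sets (F m). measure M (sym_diff (\<Union>n. A n) G) < e" if "0 < e" for e
    proof -
      obtain n where "\<bar>prob (U n) - prob (\<Union>n. U n)\<bar> < e / 2"
        using LIMSEQ_D[OF lim, of "e/2"] \<open>0 < e\<close> by auto
      moreover have "prob ((\<Union>n. U n) - U n) = prob (\<Union>n. U n) - prob (U n)"
        by (rule finite_measure_Diff) auto
      ultimately have n: "prob ((\<Union>n. U n) - U n) < e / 2" by linarith
      obtain m G where G: "G \<in> sets (F m)" "measure M (sym_diff (U n) G) < e / 2"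
        using U[of n] \<open>0 < e\<close> unfolding limit_events_def by (auto dest!: spec[of _ "e/2"])
      note FM[OF G(1), measurable]
      have "measure M (sym_diff (\<Union>n. U n) G) \<le> measure M (((\<Union>n. U n) - U n) \<union> sym_diff (U n) G)"
        by (rule finite_measure_mono) auto
      also have "\<dots> \<le> prob ((\<Union>n. U n) - U n) + prob (sym_diff (U n) G)"
        by (rule measure_Un_le) auto
      also have "\<dots> < e" using n G by simp
      finally show ?thesis using G by (auto simp: UA)
    qed
    then show "(\<Union>n. A n) \<in> limit_events M F" by (auto simp: limit_events_def)
  qed
qed

lemma (in prob_space) null_modification_limit_events:
  assumes "E \<in> limit_events M F" "E' \<in> sets M" "AE \<omega> in M. \<omega> \<in> E \<longleftrightarrow> \<omega> \<in> E'"
    and sub: "\<And>n. subalgebra M (F n)"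
  shows "E' \<in> limit_events M F"
proof -
  have "measure M (sym_diff E' G) = measure M (sym_diff E G)" if "G \<in> sets (F m)" for G m
  proof (rule finite_measure_eq_AE)
    have "G \<in> sets M" using that sub[of m] by (auto simp: subalgebra_def)
    then show "sym_diff E' G \<in> sets M" "sym_diff E G \<in> sets M"
      using assms by (auto simp: limit_events_def)
    show "AE \<omega> in M. (\<omega> \<in> sym_diff E' G) = (\<omega> \<in> sym_diff E G)"
      using assms(3) by eventually_elim auto
  qed
  then have "(\<exists>G\<in>sets (F m). measure M (sym_diff E' G) < e)
      \<longleftrightarrow> (\<exists>G\<in>sets (F m). measure M (sym_diff E G) < e)" for m e
    by (intro bex_cong) auto
  then show ?thesis using assms(1,2) by (simp add: limit_events_def)
qed

text \<open>
  The level \<open>c\<close> is detected from an approximation \<open>f m\<close> of \<open>p\<close> by comparing \<open>f m\<close> with the slightly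
  higher level \<open>c + d\<close>. A wrong decision means that \<open>f m\<close> is off by at least \<open>d\<close>, which is improbable
  for large \<open>m\<close>, or that \<open>p\<close> lies in the layer between \<open>c\<close> and \<open>c + 2 d\<close>, which is improbable for
  small \<open>d\<close> since \<open>c\<close> itself is excluded from the layer.
\<close>
lemma (in prob_space) superlevel_set_limit_event:
  fixes f :: "nat \<Rightarrow> 'a \<Rightarrow> real" and p :: "'a \<Rightarrow> real"
  assumes sub: "\<And>n. subalgebra M (F n)"
    and f: "\<And>n. f n \<in> borel_measurable (F n)" and p[measurable]: "p \<in> borel_measurable M"
    and conv: "\<And>d. 0 < d \<Longrightarrow> (\<lambda>n. prob {\<omega> \<in> space M. d \<le> \<bar>f n \<omega> - p \<omega>\<bar>}) \<longlonglongrightarrow> 0"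
  shows "{\<omega> \<in> space M. c < p \<omega>} \<in> limit_events M F"
proof -
  have "\<exists>m. \<exists>G\<in>sets (F m). prob (sym_diff {\<omega> \<in> space M. c < p \<omega>} G) < e" if e: "0 < e" for e
  proof -
    define S where "S k = {\<omega> \<in> space M. c < p \<omega> \<and> p \<omega> \<le> c + 2 / Suc k}" for k
    have [measurable]: "S k \<in> sets M" for k unfolding S_def by measurable
    have "(\<lambda>k. prob (S k)) \<longlonglongrightarrow> prob (\<Inter>k. S k)"
    proof (rule finite_Lim_measure_decseq)
      show "decseq S"
      proof (rule decseq_SucI, rule subsetI)
        fix k \<omega> assume "\<omega> \<in> S (Suc k)"
        moreover have "2 / real (Suc (Suc k)) \<le> 2 / real (Suc k)" by (simp add: field_simps)
        ultimately show "\<omega> \<in> S k" unfolding S_def by (auto intro: order_trans)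
      qed
    qed auto
    moreover have "(\<Inter>k. S k) = {}"
    proof (rule ccontr)
      assume "(\<Inter>k. S k) \<noteq> {}"
      then obtain \<omega> where "\<And>k. \<omega> \<in> S k" by auto
      then have a: "c < p \<omega>" "\<And>k. p \<omega> \<le> c + 2 / Suc k" by (auto simp: S_def)
      then obtain k where "1 / Suc k < (p \<omega> - c) / 2" using nat_approx_posE[of "(p \<omega> - c)/2"] by auto
      with a(2)[of k] show False by (simp add: field_simps)
    qed
    ultimately have "(\<lambda>k. prob (S k)) \<longlonglongrightarrow> 0" by simp
    from LIMSEQ_D[OF this, of "e/2"] e obtain k where k: "prob (S k) < e / 2" by auto
    define d where "d = 1 / real (Suc k)"
    have d: "0 < d" by (simp add: d_def)
    from LIMSEQ_D[OF conv[OF d], of "e/2"] e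
    obtain m where m: "prob {\<omega> \<in> space M. d \<le> \<bar>f m \<omega> - p \<omega>\<bar>} < e / 2" by auto
    define G where "G = {\<omega> \<in> space (F m). c + d < f m \<omega>}"
    have sp: "space (F m) = space M" using sub[of m] by (simp add: subalgebra_def)
    note f[of m, measurable]
    have G: "G \<in> sets (F m)" unfolding G_def by measurable
    have [measurable]: "f m \<in> borel_measurable M" by (rule measurable_from_subalg[OF sub f])
    have [measurable]: "G \<in> sets M" unfolding G_def sp by measurable
    have "prob (sym_diff {\<omega> \<in> space M. c < p \<omega>} G)
        \<le> prob (S k \<union> {\<omega> \<in> space M. d \<le> \<bar>f m \<omega> - p \<omega>\<bar>})"
      by (rule finite_measure_mono) (auto simp: S_def G_def sp d_def)
    also have "\<dots> \<le> prob (S k) + prob {\<omega> \<in> space M. d \<le> \<bar>f m \<omega> - p \<omega>\<bar>}"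
      by (rule measure_Un_le) auto
    also have "\<dots> < e" using k m by simp
    finally show ?thesis using G by blast
  qed
  then show ?thesis by (auto simp: limit_events_def)
qed

lemma (in prob_space) levy_zero_one:
  assumes sub: "\<And>n. subalgebra M (F n)"
    and mono: "\<And>m n. m \<le> n \<Longrightarrow> sets (F m) \<subseteq> sets (F n)"
    and E: "E \<in> limit_events M F"
  shows "AE \<omega> in M. (\<lambda>n. real_cond_exp M (F n) (indicator E) \<omega>) \<longlonglongrightarrow> indicator E \<omega>"
proof (rule levy_upward[OF sub mono])
  have [measurable]: "E \<in> sets M" using E by (simp add: limit_events_def)
  show "integrable M (indicator E :: 'a \<Rightarrow> real)" by (simp add: less_top[symmetric])
  fix e :: real assume "0 < e"
  then obtain m G where G: "G \<in> sets (F m)" "measure M (sym_diff E G) < e"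
    using E unfolding limit_events_def by blast
  have [measurable]: "G \<in> sets M" using G(1) sub[of m] by (auto simp: subalgebra_def)
  have "(\<integral>\<omega>. \<bar>indicator E \<omega> - indicator G \<omega> :: real\<bar> \<partial>M) = (\<integral>\<omega>. indicator (sym_diff E G) \<omega> \<partial>M)"
    by (rule Bochner_Integration.integral_cong) (auto simp: indicator_def)
  also have "\<dots> = measure M (sym_diff E G)" by simp
  finally show "\<exists>m g. g \<in> borel_measurable (F m) \<and> integrable M g \<and>
      (\<integral>\<omega>. \<bar>indicator E \<omega> - g \<omega>\<bar> \<partial>M) < e"
    using G by (intro exI[of _ m] exI[of _ "indicator G"]) (auto simp: less_top[symmetric])
qed

section \<open>Almost sure left inverses of injective Borel functions\<close>

text \<open>
  Lusin's theorem for a real function on a Borel subset of a Polish space. For every rational \<open>q\<close>,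
  the sets \<open>f < q\<close> and \<open>f \<ge> q\<close> contain compact sets of almost full measure. On the intersection \<open>K\<close>
  of the unions of these pairs, each of the two sets is relatively open, being the complement in \<open>K\<close>
  of the compact part of the other, so \<open>f\<close> is continuous on \<open>K\<close>.
\<close>
lemma compact_continuity_set:
  fixes f :: "'b::polish_space \<Rightarrow> real" and N :: "'b measure"
  assumes N: "finite_measure N" "sets N = sets borel"
    and T: "T \<in> sets borel" and f: "f \<in> borel_measurable (restrict_space borel T)"
    and e: "0 < e"
  obtains K where "compact K" "K \<subseteq> T" "continuous_on K f" "measure N (T - K) < e"
proof -
  interpret finite_measure N by fact
  have sp: "space N = UNIV" using N(2) sets_eq_imp_space_eq by fastforce
  have reg: "\<exists>C. compact C \<and> C \<subseteq> B \<and> measure N (B - C) < d" if B: "B \<in> sets borel" and d: "0 < d" for B d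
  proof -
    have "emeasure N B = (SUP K\<in>{K. K \<subseteq> B \<and> compact K}. emeasure N K)"
      by (rule inner_regular[OF N(2) _ B]) simp
    have "\<exists>C\<in>{K. K \<subseteq> B \<and> compact K}. measure N B - d < measure N C"
    proof (cases "measure N B < d")
      case True
      then show ?thesis by (intro bexI[of _ "{}"]) auto
    next
      case False
      then have "ennreal (measure N B - d) < emeasure N B" if "0 < measure N B"
        using d that by (simp add: emeasure_eq_measure ennreal_lessI)
      moreover have "0 < measure N B" using False d by linarith
      ultimately have "ennreal (measure N B - d) < (SUP K\<in>{K. K \<subseteq> B \<and> compact K}. emeasure N K)"
        using \<open>emeasure N B = _\<close> by simp
      then obtain C where "C \<in> {K. K \<subseteq> B \<and> compact K}" "ennreal (measure N B - d) < emeasure N C"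
        by (auto simp: less_SUP_iff)
      then show ?thesis
        using False by (auto intro!: bexI[of _ C] simp: emeasure_eq_measure ennreal_less_iff)
    qed
    then obtain C where C: "C \<subseteq> B" "compact C" "measure N B - d < measure N C" by auto
    have "C \<in> sets N" "B \<in> sets N" using C B N(2) by (auto intro: borel_compact)
    then have "measure N (B - C) = measure N B - measure N C"
      using C(1) by (intro finite_measure_Diff) auto
    then show ?thesis using C by (intro exI[of _ C]) auto
  qed
  define r :: "nat \<Rightarrow> real" where "r i = of_rat (from_nat_into UNIV i)" for i
  have r: "\<exists>i. a < r i \<and> r i < b" if "a < b" for a b
  proof -
    obtain q where "a < of_rat q" "of_rat q < b" using of_rat_dense[OF \<open>a < b\<close>] by auto
    moreover obtain i where "from_nat_into (UNIV :: rat set) i = q"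
      using from_nat_into_surj[of "UNIV :: rat set" q] by auto
    ultimately show ?thesis by (auto simp: r_def intro!: exI[of _ i])
  qed
  have meas: "{t \<in> T. f t < r i} \<in> sets borel" "{t \<in> T. r i \<le> f t} \<in> sets borel" for i
  proof -
    have "{t \<in> space (restrict_space borel T). f t < r i} \<in> sets (restrict_space borel T)"
      "{t \<in> space (restrict_space borel T). r i \<le> f t} \<in> sets (restrict_space borel T)"
      using f by measurable
    then show "{t \<in> T. f t < r i} \<in> sets borel" "{t \<in> T. r i \<le> f t} \<in> sets borel"
      using T by (auto simp: sets_restrict_space_iff space_restrict_space)
  qed
  \<comment> \<open>Two sets are trimmed for each rational, so the losses add up to at most
    \<open>e / 2\<close>.\<close>
  define d where "d i = e / 4 * (1/2)^Suc i" for i :: nat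
  have d: "0 < d i" for i using e by (simp add: d_def)
  have "\<forall>i. \<exists>C. compact C \<and> C \<subseteq> {t \<in> T. f t < r i} \<and> measure N ({t \<in> T. f t < r i} - C) < d i"
    using reg[OF meas(1) d] by blast
  from choice[OF this] obtain C where Call: "\<forall>i. compact (C i) \<and> C i \<subseteq> {t \<in> T. f t < r i} \<and>
      measure N ({t \<in> T. f t < r i} - C i) < d i" ..
  have C: "compact (C i)" "C i \<subseteq> {t \<in> T. f t < r i}" "measure N ({t \<in> T. f t < r i} - C i) < d i" for i
    using Call by blast+
  have "\<forall>i. \<exists>C. compact C \<and> C \<subseteq> {t \<in> T. r i \<le> f t} \<and> measure N ({t \<in> T. r i \<le> f t} - C) < d i"
    using reg[OF meas(2) d] by blast
  from choice[OF this] obtain C' where C'all: "\<forall>i. compact (C' i) \<and> C' i \<subseteq> {t \<in> T. r i \<le> f t} \<and>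
      measure N ({t \<in> T. r i \<le> f t} - C' i) < d i" ..
  have C': "compact (C' i)" "C' i \<subseteq> {t \<in> T. r i \<le> f t}" "measure N ({t \<in> T. r i \<le> f t} - C' i) < d i" for i
    using C'all by blast+
  define K where "K = (\<Inter>i. C i \<union> C' i)"
  have cK: "compact K"
  proof -
    have "K = (C 0 \<union> C' 0) \<inter> K" by (auto simp: K_def)
    moreover have "closed K" unfolding K_def
      by (intro closed_INT ballI closed_Un compact_imp_closed C(1) C'(1))
    moreover have "compact (C 0 \<union> C' 0)" by (intro compact_Un C(1) C'(1))
    ultimately show ?thesis by (metis compact_Int_closed)
  qed
  have KT: "K \<subseteq> T" using C(2)[of 0] C'(2)[of 0] by (auto simp: K_def)
  have cont: "continuous_on K f"
    unfolding continuous_on_eq_continuous_within continuous_within tendsto_iff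
  proof (intro ballI allI impI)
    fix x :: 'b and s :: real assume x: "x \<in> K" and s: "0 < s"
    obtain i where i: "f x - s < r i" "r i < f x" using r[of "f x - s" "f x"] s by auto
    obtain j where j: "f x < r j" "r j < f x + s" using r[of "f x" "f x + s"] s by auto
    have "x \<notin> C i" "x \<notin> C' j" using C(2)[of i] C'(2)[of j] i j by auto
    then have "x \<in> - C i \<inter> - C' j" by simp
    moreover have "open (- C i \<inter> - C' j)"
      by (intro open_Int open_Compl compact_imp_closed C(1) C'(1))
    ultimately have "eventually (\<lambda>y. y \<in> - C i \<inter> - C' j) (at x within K)"
      by (intro topological_tendstoD[OF tendsto_ident_at])
    moreover have "eventually (\<lambda>y. y \<in> K) (at x within K)" by (simp add: eventually_at_filter)
    ultimately show "eventually (\<lambda>y. dist (f y) (f x) < s) (at x within K)"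
    proof eventually_elim
      case (elim y)
      then have "y \<in> C' i" "y \<in> C j" by (auto simp: K_def)
      then have "r i \<le> f y" "f y < r j" using C'(2)[of i] C(2)[of j] by auto
      then show ?case using i j by (auto simp: dist_real_def)
    qed
  qed
  define L where "L i = ({t \<in> T. f t < r i} - C i) \<union> ({t \<in> T. r i \<le> f t} - C' i)" for i
  have Lm: "L i \<in> sets N" for i
    unfolding L_def N(2) by (intro sets.Un sets.Diff meas borel_compact C(1) C'(1))
  have L: "measure N (L i) \<le> e / 2 * (1/2)^Suc i" for i
  proof -
    have "measure N (L i) \<le> measure N ({t \<in> T. f t < r i} - C i) + measure N ({t \<in> T. r i \<le> f t} - C' i)"
      unfolding L_def
      using meas C(1) C'(1)
      by (intro measure_Un_le) (simp_all add: N(2) sets.Diff borel_compact)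
    also have "\<dots> \<le> d i + d i" using C(3)[of i] C'(3)[of i] by simp
    finally show ?thesis by (simp add: d_def)
  qed
  have "(\<lambda>i. e / 2 * (1/2)^Suc i) sums (e / 2 * 1)" by (intro sums_mult power_half_series)
  then have sm: "summable (\<lambda>i. e / 2 * (1/2)^Suc i)" "(\<Sum>i. e / 2 * (1/2)^Suc i) = e / 2"
    by (auto simp: sums_iff)
  have sL: "summable (\<lambda>i. measure N (L i))"
    by (rule summable_comparison_test'[OF sm(1), of 0]) (use L in auto)
  have "T - K \<subseteq> (\<Union>i. L i)" by (auto simp: K_def L_def not_less)
  then have "measure N (T - K) \<le> measure N (\<Union>i. L i)"
    by (rule finite_measure_mono) (use Lm in auto)
  also have "\<dots> \<le> (\<Sum>i. measure N (L i))"
    by (rule finite_measure_subadditive_countably) (use Lm sL in auto)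
  also have "\<dots> \<le> e / 2" using suminf_le[OF L sL sm(1)] sm(2) by simp
  also have "\<dots> < e" using e by simp
  finally show thesis by (rule that[OF cK KT cont])
qed

text \<open>
  On a compact set where \<open>f\<close> is continuous, \<open>f\<close> maps relatively closed subsets to compact sets. Hence
  the inverse of \<open>f\<close>, restricted to the image of a countable union \<open>U\<close> of such sets, has Borel
  preimages of closed sets. The union can be chosen to have full measure.
\<close>
lemma measurable_left_inverse:
  fixes f :: "'b::polish_space \<Rightarrow> real" and Q :: "'b measure"
  assumes T: "T \<in> sets borel" and Q: "prob_space Q" "sets Q = sets (restrict_space borel T)"
    and f: "f \<in> borel_measurable (restrict_space borel T)" and inj: "inj_on f T"
  obtains g where "g \<in> borel \<rightarrow>\<^sub>M restrict_space borel T" "AE t in Q. g (f t) = t"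
proof -
  interpret Q: prob_space Q by fact
  have spQ: "space Q = T" using sets_eq_imp_space_eq[OF Q(2)] by (simp add: space_restrict_space)
  have idm: "(\<lambda>t. t) \<in> Q \<rightarrow>\<^sub>M borel"
    unfolding measurable_cong_sets[OF Q(2) refl] by (rule measurable_restrict_space1) simp
  define N where "N = distr Q borel (\<lambda>t. t)"
  have N: "finite_measure N" "sets N = sets borel"
    using Q.prob_space_distr[OF idm] by (auto simp: N_def prob_space_def)
  have Nm: "measure N B = measure Q (B \<inter> T)" if "B \<in> sets borel" for B
    using that by (simp add: N_def measure_distr[OF idm] spQ)
  have "\<forall>j. \<exists>K. compact K \<and> K \<subseteq> T \<and> continuous_on K f \<and> measure N (T - K) < 1 / Suc j"
  proof
    fix j :: nat
    show "\<exists>K. compact K \<and> K \<subseteq> T \<and> continuous_on K f \<and> measure N (T - K) < 1 / Suc j"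
      by (rule compact_continuity_set[OF N T f, of "1 / Suc j"]) auto
  qed
  from choice[OF this] obtain K where Kall: "\<forall>j::nat. compact (K j) \<and> K j \<subseteq> T \<and> continuous_on (K j) f \<and>
      measure N (T - K j) < 1 / Suc j" ..
  have K: "compact (K j)" "K j \<subseteq> T" "continuous_on (K j) f" "measure N (T - K j) < 1 / Suc j" for j
    using Kall by blast+
  define U where "U = (\<Union>j. K j)"
  have UT: "U \<subseteq> T" using K(2) by (auto simp: U_def)
  have Um: "U \<in> sets borel" unfolding U_def by (intro sets.countable_UN) (auto intro: borel_compact K)
  have "T \<noteq> {}" using Q.not_empty spQ by simp
  then obtain t0 where t0: "t0 \<in> T" by auto
  define g where "g y = (if y \<in> f ` U then the_inv_into T f y else t0)" for y
  have gf: "g (f t) = t" if "t \<in> U" for t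
    using that UT inj by (auto simp: g_def the_inv_into_f_f)
  have img: "f ` (K j \<inter> A) \<in> sets borel" if "closed A" for j A
  proof -
    have "compact (K j \<inter> A)" by (intro compact_Int_closed K(1) that)
    then have "compact (f ` (K j \<inter> A))"
      by (intro compact_continuous_image) (auto intro: continuous_on_subset[OF K(3)])
    then show ?thesis by (rule borel_compact)
  qed
  have imgU: "f ` (U \<inter> A) \<in> sets borel" if "closed A" for A
  proof -
    have "f ` (U \<inter> A) = (\<Union>j. f ` (K j \<inter> A))" by (auto simp: U_def)
    then show ?thesis using img[OF that] by auto
  qed
  have "g \<in> borel_measurable borel"
  proof (rule measurable_sigma_sets[of _ UNIV "Collect closed"])
    show "sets borel = sigma_sets UNIV (Collect closed :: 'b set set)"
      by (subst borel_eq_closed) simp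
    fix A :: "'b set" assume "A \<in> Collect closed"
    then have A: "closed A" by simp
    have "g -` A = f ` (U \<inter> A) \<union> (if t0 \<in> A then - f ` (U \<inter> UNIV) else {})"
      by (auto simp: g_def the_inv_into_f_f[OF inj] subsetD[OF UT] split: if_splits)
    then show "g -` A \<inter> space borel \<in> sets borel"
      using imgU[OF A] imgU[OF closed_UNIV] by auto
  qed auto
  moreover have "g y \<in> T" for y
    using t0 UT by (auto simp: g_def the_inv_into_f_f[OF inj] subsetD[OF UT])
  ultimately have "g \<in> borel \<rightarrow>\<^sub>M restrict_space borel T"
    by (intro measurable_restrict_space2) auto
  moreover have "AE t in Q. g (f t) = t"
  proof -
    have Km: "T - K j \<in> sets borel" for j by (rule sets.Diff[OF T borel_compact[OF K(1)]])
    have "measure Q (T - U) \<le> 1 / Suc j" for j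
    proof -
      have "measure Q (T - U) = measure N (T - U)"
        using T Um by (subst Nm) (auto intro!: arg_cong[where f = "measure Q"])
      also have "\<dots> \<le> measure N (T - K j)"
        by (rule finite_measure.finite_measure_mono[OF N(1)]) (auto simp: U_def N(2) Km)
      finally show ?thesis using K(4)[of j] by simp
    qed
    moreover have "\<exists>j. 1 / real (Suc j) < measure Q (T - U)" if "0 < measure Q (T - U)"
      using nat_approx_posE[OF that] by blast
    ultimately have "\<not> 0 < measure Q (T - U)" by (meson not_less)
    then have "measure Q (T - U) = 0" using measure_nonneg[of Q "T - U"] by linarith
    moreover have "T - U \<in> sets Q" using T Um by (auto simp: Q(2) sets_restrict_space_iff)
    ultimately have "AE t in Q. t \<notin> T - U"
      by (intro AE_not_in) (simp add: null_sets_def Q.emeasure_eq_measure)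
    then show ?thesis using AE_space by eventually_elim (use gf spQ in auto)
  qed
  ultimately show thesis by (rule that)
qed

text \<open>
  The point of the Cantor set whose ternary digits \<open>0\<close> and \<open>2\<close> record membership in the sets \<open>D k\<close>.
  The gaps of the Cantor set make the code injective when the sets separate points.
\<close>
definition ternary_code :: "(nat \<Rightarrow> 'b set) \<Rightarrow> 'b \<Rightarrow> real" where
  "ternary_code D t = (\<Sum>k. indicator (D k) t * 2 * (1/3) ^ Suc k)"

lemma summable_ternary_code: "summable (\<lambda>k. indicator (D k) t * 2 * (1/3) ^ Suc k :: real)"
proof (rule summable_comparison_test')
  show "summable (\<lambda>k. 2 * (1/3) ^ Suc k :: real)"
    by (intro summable_mult) (simp add: summable_geometric)
qed (auto simp: indicator_def)

lemma ternary_tail: "(\<lambda>k. 2 * (1/3) ^ Suc (k + n)) sums ((1/3 :: real) ^ n)"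
proof -
  have "(\<lambda>k. (2 * (1/3) ^ Suc n) * (1/3) ^ k) sums ((2 * (1/3) ^ Suc n) * (1 / (1 - 1/3 :: real)))"
    by (intro sums_mult geometric_sums) simp
  then show ?thesis by (simp add: power_add mult_ac)
qed

lemma ternary_code_bounds: "0 \<le> ternary_code D t" "ternary_code D t \<le> 1"
proof -
  show "0 \<le> ternary_code D t"
    unfolding ternary_code_def by (rule suminf_nonneg[OF summable_ternary_code]) simp
  have "ternary_code D t \<le> (\<Sum>k. 2 * (1/3) ^ Suc (k + 0))"
    unfolding ternary_code_def
    by (rule suminf_le[OF _ summable_ternary_code sums_summable[OF ternary_tail]])
       (auto simp: indicator_def)
  also have "\<dots> = 1" using sums_unique[OF ternary_tail[of 0]] by simp
  finally show "ternary_code D t \<le> 1" .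
qed

text \<open>
  At the first index where \<open>s\<close> and \<open>t\<close> differ, \<open>t\<close> gains \<open>2 / 3^(n+1)\<close>, while all later digits of \<open>s\<close>
  together contribute at most \<open>1 / 3^(n+1)\<close>.
\<close>
lemma ternary_code_less:
  assumes n: "s \<notin> D n" "t \<in> D n" and less: "\<And>k. k < n \<Longrightarrow> s \<in> D k \<longleftrightarrow> t \<in> D k"
  shows "ternary_code D s < ternary_code D t"
proof -
  let ?a = "\<lambda>x k. indicator (D k) x * 2 * (1/3) ^ Suc k :: real"
  have split: "ternary_code D x = (\<Sum>k. ?a x (k + Suc n)) + (\<Sum>k<n. ?a x k) + ?a x n" for x
    unfolding ternary_code_def
    by (subst suminf_split_initial_segment[OF summable_ternary_code, of D x "Suc n"]) simp
  have "(\<Sum>k. ?a s (k + Suc n)) \<le> (\<Sum>k. 2 * (1/3) ^ Suc (k + Suc n))"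
    by (rule suminf_le[OF _ summable_ignore_initial_segment[OF summable_ternary_code]
          sums_summable[OF ternary_tail]]) (auto simp: indicator_def)
  also have "\<dots> = (1/3) ^ Suc n" using sums_unique[OF ternary_tail[of "Suc n"]] by simp
  also have "\<dots> < 2 * (1/3) ^ Suc n" by simp
  also have "\<dots> = ?a t n" using n by simp
  finally have "(\<Sum>k. ?a s (k + Suc n)) < ?a t n" .
  moreover have "0 \<le> (\<Sum>k. ?a t (k + Suc n))"
    by (rule suminf_nonneg[OF summable_ignore_initial_segment[OF summable_ternary_code]]) simp
  moreover have "(\<Sum>k<n. ?a s k) = (\<Sum>k<n. ?a t k)"
    by (rule sum.cong) (use less in \<open>auto simp: indicator_def\<close>)
  moreover have "?a s n = 0" using n by simp
  ultimately show ?thesis using split[of s] split[of t] by linarith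
qed

lemma inj_on_ternary_code:
  assumes sep: "\<And>s t. s \<in> T \<Longrightarrow> t \<in> T \<Longrightarrow> s \<noteq> t \<Longrightarrow> \<exists>k. (s \<in> D k) \<noteq> (t \<in> D k)"
  shows "inj_on (ternary_code D) T"
proof (rule inj_onI, rule ccontr)
  fix s t assume st: "s \<in> T" "t \<in> T" "ternary_code D s = ternary_code D t" "s \<noteq> t"
  define n where "n = (LEAST k. (s \<in> D k) \<noteq> (t \<in> D k))"
  have n: "(s \<in> D n) \<noteq> (t \<in> D n)" unfolding n_def by (rule LeastI_ex) (rule sep[OF st(1,2,4)])
  have "s \<in> D k \<longleftrightarrow> t \<in> D k" if "k < n" for k
    using not_less_Least[OF that[unfolded n_def]] by auto
  with n st(3) show False
    using ternary_code_less[of s D n t] ternary_code_less[of t D n s] by (cases "s \<in> D n") auto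
qed

lemma borel_measurable_ternary_code:
  assumes "\<And>k. D k \<inter> space M \<in> sets M"
  shows "ternary_code D \<in> borel_measurable M"
proof -
  have "(\<lambda>t. \<Sum>k. indicator (D k \<inter> space M) t * 2 * (1/3) ^ Suc k :: real) \<in> borel_measurable M"
    using assms by (intro borel_measurable_suminf borel_measurable_times borel_measurable_const
        borel_measurable_indicator)
  also have "?this \<longleftrightarrow> ?thesis"
    unfolding ternary_code_def
    by (intro measurable_cong suminf_cong) (auto simp: indicator_def)
  finally show ?thesis .
qed

section \<open>Regular conditional distributions\<close>

text \<open>
  The set where \<open>h < f\<close> would violate the comparison of integrals unless it is null; finiteness allows
  the two integrals over it to be subtracted.
\<close>
lemma AE_le_if_nn_integral_le:
  fixes f h :: "'a \<Rightarrow> ennreal"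
  assumes [measurable]: "f \<in> borel_measurable N" "h \<in> borel_measurable N"
    and fin: "(\<integral>\<^sup>+ y. h y \<partial>N) < \<infinity>"
    and le: "\<And>A. A \<in> sets N \<Longrightarrow> (\<integral>\<^sup>+ y. f y * indicator A y \<partial>N) \<le> (\<integral>\<^sup>+ y. h y * indicator A y \<partial>N)"
  shows "AE y in N. f y \<le> h y"
proof -
  define A where "A = {y \<in> space N. h y < f y}"
  have A[measurable]: "A \<in> sets N" unfolding A_def by measurable
  have fin': "(\<integral>\<^sup>+ y. h y * indicator A y \<partial>N) \<noteq> \<infinity>"
  proof -
    have "(\<integral>\<^sup>+ y. h y * indicator A y \<partial>N) \<le> (\<integral>\<^sup>+ y. h y \<partial>N)"
      by (rule nn_integral_mono) (auto simp: indicator_def)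
    then show ?thesis using fin by auto
  qed
  have "(\<integral>\<^sup>+ y. f y * indicator A y - h y * indicator A y \<partial>N)
      = (\<integral>\<^sup>+ y. f y * indicator A y \<partial>N) - (\<integral>\<^sup>+ y. h y * indicator A y \<partial>N)"
    by (rule nn_integral_diff) (use fin' in \<open>auto simp: indicator_def A_def\<close>)
  also have "\<dots> = 0" using le[OF A] fin' by (simp add: diff_eq_0_iff_ennreal less_top)
  finally have "AE y in N. f y * indicator A y - h y * indicator A y = 0"
    by (subst (asm) nn_integral_0_iff_AE) auto
  moreover have "AE y in N. h y \<noteq> \<infinity>" by (rule nn_integral_noteq_infinite) (use fin in auto)
  ultimately show ?thesis using AE_space
  proof eventually_elim
    case (elim y)
    show ?case
    proof (rule ccontr)
      assume "\<not> f y \<le> h y"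
      then have "h y < f y" "y \<in> A" using elim by (auto simp: A_def)
      then show False using elim by (auto simp: diff_eq_0_iff_ennreal)
    qed
  qed
qed

text \<open>
  The conditional probability of \<open>E\<close> given the value of \<open>g\<close>, as a function of that value: the
  Radon-Nikodym derivative of the image under \<open>g\<close> of \<open>M\<close> restricted to \<open>E\<close> with respect to the image
  of \<open>M\<close>. It is at most \<open>1\<close> almost everywhere and is cut off to be so everywhere.
\<close>
lemma (in prob_space) conditional_probability_given_map:
  assumes g[measurable]: "g \<in> M \<rightarrow>\<^sub>M Y" and E[measurable]: "E \<in> sets M"
  obtains h :: "'c \<Rightarrow> real" where "h \<in> borel_measurable Y" "\<And>y. 0 \<le> h y" "\<And>y. h y \<le> 1"
    "\<And>A. A \<in> sets Y \<Longrightarrow>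
      (\<integral>\<^sup>+ y. ennreal (h y) * indicator A y \<partial>distr M Y g) = emeasure M (g -` A \<inter> E)"
proof -
  define N where "N = distr M Y g"
  define R where "R = distr (density M (indicator E)) Y g"
  interpret N: prob_space N unfolding N_def by (rule prob_space_distr) (rule g)
  have setsN[measurable_cong]: "sets N = sets Y" by (simp add: N_def)
  have N: "emeasure N A = emeasure M (g -` A \<inter> space M)" if "A \<in> sets Y" for A
    using that by (simp add: N_def emeasure_distr)
  have R: "emeasure R A = emeasure M (g -` A \<inter> E)" if [measurable]: "A \<in> sets Y" for A
  proof -
    have "emeasure R A = emeasure (density M (indicator E)) (g -` A \<inter> space M)"
      unfolding R_def by (subst emeasure_distr) (simp_all add: g)
    also have "\<dots> = emeasure M (E \<inter> (g -` A \<inter> space M))"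
      by (rule emeasure_restricted) measurable
    also have "E \<inter> (g -` A \<inter> space M) = g -` A \<inter> E" using sets.sets_into_space[OF E] by auto
    finally show ?thesis .
  qed
  have "absolutely_continuous N R"
    unfolding absolutely_continuous_def
  proof
    fix A assume "A \<in> null_sets N"
    then have A: "A \<in> sets Y" "emeasure N A = 0" by (auto simp: N_def)
    have "emeasure M (g -` A \<inter> E) \<le> emeasure M (g -` A \<inter> space M)"
      using A(1) sets.sets_into_space[OF E] by (intro emeasure_mono) auto
    then show "A \<in> null_sets R" using A N[OF A(1)] R[OF A(1)] by (auto simp: R_def)
  qed
  then obtain f where f[measurable]: "f \<in> borel_measurable N" and dens: "density N f = R"
    using N.Radon_Nikodym[of R] by (auto simp: R_def N_def)
  have int: "(\<integral>\<^sup>+ y. f y * indicator A y \<partial>N) = emeasure M (g -` A \<inter> E)" if "A \<in> sets Y" for A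
    using that R[OF that] by (simp add: dens[symmetric] emeasure_density N_def)
  have "AE y in N. f y \<le> 1"
  proof (rule AE_le_if_nn_integral_le)
    fix A assume "A \<in> sets N"
    then have A: "A \<in> sets Y" by (simp add: N_def)
    have "emeasure M (g -` A \<inter> E) \<le> emeasure M (g -` A \<inter> space M)"
      using A sets.sets_into_space[OF E] by (intro emeasure_mono) auto
    then show "(\<integral>\<^sup>+ y. f y * indicator A y \<partial>N) \<le> (\<integral>\<^sup>+ y. 1 * indicator A y \<partial>N)"
      using A \<open>A \<in> sets N\<close> by (simp add: int N[symmetric])
  qed (auto simp: N.emeasure_space_1)
  then have fh: "AE y in N. ennreal (enn2real (min 1 (f y))) = f y"
    by eventually_elim (auto simp: min_def ennreal_enn2real_if top_unique)
  show thesis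
  proof (rule that[of "\<lambda>y. enn2real (min 1 (f y))"])
    show "(\<lambda>y. enn2real (min 1 (f y))) \<in> borel_measurable Y" using f by measurable
    fix y show "0 \<le> enn2real (min 1 (f y))" by simp
    show "enn2real (min 1 (f y)) \<le> 1"
      using enn2real_mono[of "min 1 (f y)" 1] by simp
  next
    fix A assume A: "A \<in> sets Y"
    have "(\<integral>\<^sup>+ y. ennreal (enn2real (min 1 (f y))) * indicator A y \<partial>N) = (\<integral>\<^sup>+ y. f y * indicator A y \<partial>N)"
      by (rule nn_integral_cong_AE) (use fh in eventually_elim, simp)
    then show "(\<integral>\<^sup>+ y. ennreal (enn2real (min 1 (f y))) * indicator A y \<partial>distr M Y g)
        = emeasure M (g -` A \<inter> E)"
      using int[OF A] by (simp add: N_def)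
  qed
qed

text \<open>
  The conditional probabilities \<open>h t\<close> of \<open>Z \<le> t\<close> are each determined only up to a null set, so they
  need not form a distribution function at any given point. The function \<open>F y x\<close>, the infimum of
  \<open>h q y\<close> over the rationals \<open>q > x\<close>, is monotone and right continuous in \<open>x\<close> for every \<open>y\<close> whatever
  the choice of the versions, and it is still a version of the conditional probability of \<open>Z \<le> x\<close>.
\<close>
lemma (in prob_space) regular_conditional_distribution_unit_interval:
  fixes Z :: "'a \<Rightarrow> real"
  assumes g[measurable]: "g \<in> M \<rightarrow>\<^sub>M Y" and Z[measurable]: "Z \<in> borel_measurable M"
    and Z01: "\<And>\<omega>. 0 \<le> Z \<omega>" "\<And>\<omega>. Z \<omega> \<le> 1"
  obtains \<kappa> where "\<kappa> \<in> Y \<rightarrow>\<^sub>M prob_algebra borel"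
    "\<And>A B. A \<in> sets Y \<Longrightarrow> B \<in> sets borel \<Longrightarrow>
      (\<integral>\<^sup>+ y. emeasure (\<kappa> y) B * indicator A y \<partial>distr M Y g) = emeasure M {\<omega> \<in> space M. g \<omega> \<in> A \<and> Z \<omega> \<in> B}"
proof -
  define N where "N = distr M Y g"
  interpret N: prob_space N unfolding N_def by (rule prob_space_distr) (rule g)
  have setsN[measurable_cong]: "sets N = sets Y" by (simp add: N_def)
  define m where "m A t = emeasure M {\<omega> \<in> space M. g \<omega> \<in> A \<and> Z \<omega> \<le> t}" for A t
  \<comment> \<open>Since \<open>Z\<close> lies in the unit interval, the versions can be taken constant below \<open>0\<close>
    and from \<open>1\<close> on. This gives \<open>F y\<close> the limits \<open>0\<close> and \<open>1\<close> at infinity for every \<open>y\<close>.\<close>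
  have "\<exists>h. h \<in> borel_measurable Y \<and> (\<forall>y. 0 \<le> h y \<and> h y \<le> 1) \<and> (t < 0 \<longrightarrow> h = (\<lambda>_. 0)) \<and> (1 \<le> t \<longrightarrow> h = (\<lambda>_. 1)) \<and>
      (\<forall>A\<in>sets Y. (\<integral>\<^sup>+ y. ennreal (h y) * indicator A y \<partial>N) = m A t)" for t :: real
  proof -
    consider "t < 0" | "1 \<le> t" | "0 \<le> t" "t < 1" by linarith
    then show ?thesis
    proof cases
      case 1
      then have "\<not> Z \<omega> \<le> t" for \<omega> using Z01(1)[of \<omega>] by linarith
      then show ?thesis using 1 by (intro exI[of _ "\<lambda>_. 0"]) (simp add: m_def)
    next
      case 2
      have "{\<omega> \<in> space M. g \<omega> \<in> A \<and> Z \<omega> \<le> t} = g -` A \<inter> space M" for A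
        using Z01(2) 2 by (auto intro: order_trans)
      then show ?thesis using 2
        by (intro exI[of _ "\<lambda>_. 1"]) (auto simp: m_def N_def emeasure_distr)
    next
      case 3
      have E: "{\<omega> \<in> space M. Z \<omega> \<le> t} \<in> sets M" by measurable
      obtain h :: "_ \<Rightarrow> real" where "h \<in> borel_measurable Y" "\<And>y. 0 \<le> h y" "\<And>y. h y \<le> 1"
        "\<And>A. A \<in> sets Y \<Longrightarrow> (\<integral>\<^sup>+ y. ennreal (h y) * indicator A y \<partial>distr M Y g)
            = emeasure M (g -` A \<inter> {\<omega> \<in> space M. Z \<omega> \<le> t})"
        by (rule conditional_probability_given_map[OF g E]) blast
      moreover have "g -` A \<inter> {\<omega> \<in> space M. Z \<omega> \<le> t} = {\<omega> \<in> space M. g \<omega> \<in> A \<and> Z \<omega> \<le> t}" for A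
        by auto
      ultimately show ?thesis using 3 by (intro exI[of _ h]) (simp add: m_def N_def)
    qed
  qed
  then have "\<forall>t. \<exists>h. h \<in> borel_measurable Y \<and> (\<forall>y. 0 \<le> h y \<and> h y \<le> 1) \<and> (t < 0 \<longrightarrow> h = (\<lambda>_. 0)) \<and> (1 \<le> t \<longrightarrow> h = (\<lambda>_. 1)) \<and>
      (\<forall>A\<in>sets Y. (\<integral>\<^sup>+ y. ennreal (h y) * indicator A y \<partial>N) = m A t)" by blast
  from choice[OF this] obtain h :: "real \<Rightarrow> 'b \<Rightarrow> real" where h: "\<forall>t. h t \<in> borel_measurable Y \<and> (\<forall>y. 0 \<le> h t y \<and> h t y \<le> 1) \<and>
      (t < 0 \<longrightarrow> h t = (\<lambda>_. 0)) \<and> (1 \<le> t \<longrightarrow> h t = (\<lambda>_. 1)) \<and>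
      (\<forall>A\<in>sets Y. (\<integral>\<^sup>+ y. ennreal (h t y) * indicator A y \<partial>N) = m A t)" ..
  have [measurable]: "h t \<in> borel_measurable Y" for t using h by blast
  have h01: "0 \<le> h t y" "h t y \<le> 1" for t y using h by blast+
  have hlow: "t < 0 \<Longrightarrow> h t y = 0" and hhigh: "1 \<le> t \<Longrightarrow> h t y = 1" for t y
    using h by simp_all
  have hint: "(\<integral>\<^sup>+ y. ennreal (h t y) * indicator A y \<partial>N) = m A t" if "A \<in> sets Y" for A t
    using h that by blast
  have m_mono: "m A s \<le> m A t" if "s \<le> t" "A \<in> sets Y" for A s t
    unfolding m_def using that by (intro emeasure_mono) auto
  have h_mono: "AE y in N. h s y \<le> h t y" if "s \<le> t" for s t
  proof -
    have "AE y in N. ennreal (h s y) \<le> ennreal (h t y)"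
    proof (rule AE_le_if_nn_integral_le)
      have "(\<integral>\<^sup>+ y. ennreal (h t y) \<partial>N) \<le> (\<integral>\<^sup>+ y. 1 \<partial>N)"
        by (rule nn_integral_mono) (simp add: h01)
      then show "(\<integral>\<^sup>+ y. ennreal (h t y) \<partial>N) < \<infinity>"
        by (simp add: N.emeasure_space_1) (auto intro: le_less_trans)
    qed (auto simp: hint m_mono that setsN)
    then show ?thesis by eventually_elim (simp add: h01)
  qed
  define I where "I x = {q \<in> \<rat>. x < q}" for x :: real
  define F where "F y x = (INF q\<in>I x. h q y)" for y x
  have Ine: "\<exists>q\<in>I x. q < x + d" if "0 < d" for x d
    using Rats_dense_in_real[of x "x + d"] that by (auto simp: I_def)
  then have Ine': "I x \<noteq> {}" for x using zero_less_one by blast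
  have bdd: "bdd_below ((\<lambda>q. h q y) ` I x)" for y x
    using h01(1) by (auto intro!: bdd_belowI[of _ 0])
  have F_le: "F y x \<le> h q y" if "q \<in> I x" for y x q
    unfolding F_def by (rule cINF_lower[OF bdd that])
  have F_ge: "c \<le> F y x" if "\<And>q. q \<in> I x \<Longrightarrow> c \<le> h q y" for c y x
    unfolding F_def by (rule cINF_greatest[OF Ine' that])
  have F0: "0 \<le> F y x" for y x by (rule F_ge) (rule h01)
  have F1: "F y x \<le> 1" for y x using F_le h01(2) Ine' by (meson ex_in_conv order_trans)
  have F_mono: "F y s \<le> F y t" if "s \<le> t" for y s t
    by (rule F_ge, rule F_le) (use that in \<open>auto simp: I_def\<close>)
  have F_low: "F y x = 0" if "x < 0" for y x
  proof -
    have "\<exists>q\<in>I x. q < 0" using Ine[of "- x" x] that by simp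
    then obtain q where "q \<in> I x" "q < 0" ..
    then show ?thesis using F_le[of q x y] F0[of y x] hlow[of q y] by simp
  qed
  have F_high: "F y x = 1" if "1 \<le> x" for y x
    by (rule antisym[OF F1], rule F_ge) (use that hhigh in \<open>auto simp: I_def\<close>)
  have F_right: "continuous (at_right a) (F y)" for y a
    unfolding continuous_within tendsto_iff
  proof (intro allI impI)
    fix e :: real assume "0 < e"
    then have "\<exists>v\<in>(\<lambda>q. h q y) ` I a. v < F y a + e"
      using Ine'[of a] bdd[of y a] by (intro cInf_lessD) (auto simp: F_def)
    then obtain q where q: "q \<in> I a" "h q y < F y a + e" by auto
    then have "a < q" by (simp add: I_def)
    then have "eventually (\<lambda>x. a < x \<and> x < q) (at_right a)"
      using eventually_at_right by blast
    then show "eventually (\<lambda>x. dist (F y x) (F y a) < e) (at_right a)"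
    proof eventually_elim
      case (elim x)
      then have "F y x \<le> h q y" using q by (intro F_le) (auto simp: I_def)
      then show ?case using q F_mono[of a x y] elim by (simp add: dist_real_def)
    qed
  qed
  have F_bot: "(F y \<longlongrightarrow> 0) at_bot" for y
    by (rule tendsto_eventually) (auto simp: eventually_at_bot_dense F_low intro!: exI[of _ 0])
  have F_top: "(F y \<longlongrightarrow> 1) at_top" for y
    by (rule tendsto_eventually) (auto simp: eventually_at_top_linorder F_high intro!: exI[of _ 1])
  have cI: "countable (I x)" for x
    unfolding I_def by (rule countable_subset[OF _ countable_rat]) auto
  have F_meas[measurable]: "(\<lambda>y. F y x) \<in> borel_measurable Y" for x
    unfolding F_def by (rule borel_measurable_cINF[OF cI]) (use bdd in auto)
  have F_int: "(\<integral>\<^sup>+ y. ennreal (F y x) * indicator A y \<partial>N) = m A x" if A: "A \<in> sets Y" for A x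
  proof (rule antisym)
    have "AE y in N. \<forall>q\<in>I x. h x y \<le> h q y"
      unfolding AE_ball_countable[OF cI] by (intro ballI h_mono) (simp add: I_def)
    then have "AE y in N. ennreal (h x y) * indicator A y \<le> ennreal (F y x) * indicator A y"
      by eventually_elim (auto intro!: mult_right_mono ennreal_leI F_ge)
    then show "m A x \<le> (\<integral>\<^sup>+ y. ennreal (F y x) * indicator A y \<partial>N)"
      unfolding hint[OF A, symmetric] by (rule nn_integral_mono_AE)
    \<comment> \<open>Conversely \<open>F y x\<close> lies below \<open>h q y\<close> for rationals \<open>q\<close> just above \<open>x\<close>, and the
      probabilities of \<open>Z \<le> x + 1/(n+1)\<close> decrease to that of \<open>Z \<le> x\<close>.\<close>
    define S where "S n = {\<omega> \<in> space M. g \<omega> \<in> A \<and> Z \<omega> \<le> x + 1 / Suc n}" for n :: nat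
    have [measurable]: "A \<in> sets Y" by (rule A)
    have "(\<lambda>n. emeasure M (S n)) \<longlonglongrightarrow> emeasure M (\<Inter>n. S n)"
    proof (rule Lim_emeasure_decseq)
      show "decseq S"
      proof (rule decseq_SucI, rule subsetI)
        fix k \<omega> assume "\<omega> \<in> S (Suc k)"
        moreover have "1 / real (Suc (Suc k)) \<le> 1 / real (Suc k)" by (simp add: field_simps)
        ultimately show "\<omega> \<in> S k" unfolding S_def by (auto intro: order_trans)
      qed
    qed (auto simp: S_def)
    also have "(\<Inter>n. S n) = {\<omega> \<in> space M. g \<omega> \<in> A \<and> Z \<omega> \<le> x}"
    proof (intro equalityI subsetI)
      fix \<omega> assume "\<omega> \<in> (\<Inter>n. S n)"
      then have s: "\<omega> \<in> space M" "g \<omega> \<in> A" "\<And>n. Z \<omega> \<le> x + 1 / Suc n" by (auto simp: S_def)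
      have "Z \<omega> \<le> x + e" if "0 < e" for e
        using nat_approx_posE[OF that] s(3) by (meson add_left_mono less_imp_le order_trans)
      then show "\<omega> \<in> {\<omega> \<in> space M. g \<omega> \<in> A \<and> Z \<omega> \<le> x}"
        using s field_le_epsilon by blast
    qed (auto simp: S_def intro: order_trans)
    finally have lim: "(\<lambda>n. emeasure M (S n)) \<longlonglongrightarrow> m A x" by (simp add: m_def)
    show "(\<integral>\<^sup>+ y. ennreal (F y x) * indicator A y \<partial>N) \<le> m A x"
    proof (rule LIMSEQ_le_const[OF lim], intro exI[of _ 0] allI impI)
      fix n :: nat
      obtain q where q: "q \<in> I x" "q < x + 1 / Suc n" using Ine[of "1 / Suc n" x] by auto
      have "(\<integral>\<^sup>+ y. ennreal (F y x) * indicator A y \<partial>N) \<le> (\<integral>\<^sup>+ y. ennreal (h q y) * indicator A y \<partial>N)"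
        by (rule nn_integral_mono) (auto simp: indicator_def intro!: ennreal_leI F_le q)
      also have "\<dots> = m A q" by (rule hint[OF A])
      also have "\<dots> \<le> m A (x + 1 / Suc n)" using q by (intro m_mono A) simp
      finally show "(\<integral>\<^sup>+ y. ennreal (F y x) * indicator A y \<partial>N) \<le> emeasure M (S n)"
        by (simp add: m_def S_def)
    qed
  qed
  define \<kappa> where "\<kappa> y = interval_measure (F y)" for y
  have \<kappa>_Iic: "emeasure (\<kappa> y) {..x} = F y x" for y x
    unfolding \<kappa>_def by (rule emeasure_interval_measure_Iic[OF F_mono F_right F_bot])
  have \<kappa>_prob: "prob_space (\<kappa> y)" for y
    unfolding \<kappa>_def
    using real_distribution_interval_measure[OF F_mono F_right F_bot F_top]
    by (simp add: real_distribution_def)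
  have \<kappa>: "\<kappa> \<in> Y \<rightarrow>\<^sub>M prob_algebra borel"
  proof (rule measurable_prob_algebra_generated[where \<Omega> = UNIV and G = "range (\<lambda>a::real. {..a})"])
    show "sets borel = sigma_sets UNIV (range (\<lambda>a::real. {..a}))"
      by (subst borel_eq_atMost) simp
    show "Int_stable (range (\<lambda>a::real. {..a}))" by (auto simp: Int_stable_def)
    fix B assume "B \<in> range (\<lambda>a::real. {..a})"
    then obtain x where B: "B = {..x}" by auto
    show "(\<lambda>y. emeasure (\<kappa> y) B) \<in> borel_measurable Y" unfolding B \<kappa>_Iic by measurable
  qed (auto simp: \<kappa>_prob, simp_all add: \<kappa>_def)
  show thesis
  proof (rule that[OF \<kappa>])
    fix A :: "'b set" and B :: "real set" assume A: "A \<in> sets Y" and B: "B \<in> sets borel"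
    have [measurable]: "A \<in> sets Y" by (rule A)
    define E where "E = g -` A \<inter> space M"
    have E[measurable]: "E \<in> sets M" unfolding E_def by measurable
    \<comment> \<open>For fixed \<open>A\<close> both sides are finite measures in \<open>B\<close> with the same distribution
      function.\<close>
    define m1 where "m1 = density N (indicator A) \<bind> \<kappa>"
    define m2 where "m2 = distr (density M (indicator E)) borel Z"
    have \<kappa>': "\<kappa> \<in> density N (indicator A) \<rightarrow>\<^sub>M subprob_algebra borel"
      using measurable_prob_algebraD[OF \<kappa>] by (simp add: N_def cong: measurable_cong_sets)
    have ne: "space (density N (indicator A)) \<noteq> {}" using N.not_empty by simp
    have m1: "emeasure m1 C = (\<integral>\<^sup>+ y. emeasure (\<kappa> y) C * indicator A y \<partial>N)" if "C \<in> sets borel" for C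
    proof -
      have [measurable]: "(\<lambda>y. emeasure (\<kappa> y) C) \<in> borel_measurable N"
        using \<kappa>' that by (auto simp: N_def intro: measurable_emeasure_subprob_algebra
            measurable_compose[OF measurable_prob_algebraD[OF \<kappa>]])
      show ?thesis unfolding m1_def emeasure_bind[OF ne \<kappa>' that]
        by (subst nn_integral_density) (auto simp: mult.commute)
    qed
    have m2: "emeasure m2 C = emeasure M {\<omega> \<in> space M. g \<omega> \<in> A \<and> Z \<omega> \<in> C}" if C: "C \<in> sets borel" for C
    proof -
      have [measurable]: "C \<in> sets borel" by (rule C)
      have "emeasure m2 C = emeasure (density M (indicator E)) (Z -` C \<inter> space M)"
        unfolding m2_def by (subst emeasure_distr) (simp_all add: C)
      also have "\<dots> = emeasure M (E \<inter> (Z -` C \<inter> space M))"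
        by (rule emeasure_restricted) measurable
      also have "E \<inter> (Z -` C \<inter> space M) = {\<omega> \<in> space M. g \<omega> \<in> A \<and> Z \<omega> \<in> C}"
        by (auto simp: E_def)
      finally show ?thesis .
    qed
    have s1: "sets m1 = sets borel" unfolding m1_def by (rule sets_bind[OF _ ne])
        (use \<kappa>' in \<open>auto dest: subprob_measurableD(2)\<close>)
    have s2: "sets m2 = sets borel" by (simp add: m2_def)
    have fin2: "emeasure m2 C < \<infinity>" if "C \<in> sets borel" for C
      unfolding m2[OF that] by (simp add: emeasure_eq_measure)
    have Iic: "emeasure m1 {..x} = emeasure m2 {..x}" for x
      using F_int[OF A, of x] by (simp add: m1 m2 \<kappa>_Iic m_def)
    have tot: "emeasure m1 UNIV = emeasure m2 UNIV"
    proof -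
      have "emeasure (\<kappa> y) UNIV = 1" for y
        using prob_space.emeasure_space_1[OF \<kappa>_prob[of y]] by (simp add: \<kappa>_def)
      then have "emeasure m1 UNIV = (\<integral>\<^sup>+ y. indicator A y \<partial>N)" by (simp add: m1)
      also have "\<dots> = emeasure m2 UNIV"
        by (simp add: m2 N_def emeasure_distr vimage_def Int_def conj_commute)
      finally show ?thesis .
    qed
    have "m1 = m2"
    proof (rule cdf_unique')
      have sp: "space m1 = UNIV" "space m2 = UNIV"
        using sets_eq_imp_space_eq[OF s1] sets_eq_imp_space_eq[OF s2] by auto
      show "finite_borel_measure m1" "finite_borel_measure m2"
        unfolding finite_borel_measure_def finite_borel_measure_axioms_def
        using fin2[of UNIV] tot s1 s2 by (auto intro!: finite_measureI simp: sp)
      show "cdf m1 = cdf m2" by (simp add: cdf_def measure_def Iic fun_eq_iff)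
    qed
    then show "(\<integral>\<^sup>+ y. emeasure (\<kappa> y) B * indicator A y \<partial>distr M Y g)
        = emeasure M {\<omega> \<in> space M. g \<omega> \<in> A \<and> Z \<omega> \<in> B}"
      using m1[OF B] m2[OF B] by (simp add: N_def)
  qed
qed


text \<open>
  Membership in the sets of a countable base encodes the points of \<open>T\<close> as numbers in the unit interval.
  The conditional distribution of the code is carried back to \<open>T\<close> by the left inverse \<open>\<psi>\<close>; since
  \<open>\<psi>\<close> takes values in \<open>T\<close> everywhere, every conditional distribution is a probability measure on \<open>T\<close>.
\<close>
theorem (in prob_space) regular_conditional_distribution:
  fixes Z :: "'a \<Rightarrow> 'b::polish_space"
  assumes g[measurable]: "g \<in> M \<rightarrow>\<^sub>M Y" and T: "T \<in> sets borel"
    and Z[measurable]: "Z \<in> M \<rightarrow>\<^sub>M restrict_space borel T"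
  obtains \<kappa> where "\<kappa> \<in> Y \<rightarrow>\<^sub>M prob_algebra (restrict_space borel T)"
    "\<And>A B. A \<in> sets Y \<Longrightarrow> B \<in> sets (restrict_space borel T) \<Longrightarrow>
      (\<integral>\<^sup>+ y. emeasure (\<kappa> y) B * indicator A y \<partial>distr M Y g) = emeasure M {\<omega> \<in> space M. g \<omega> \<in> A \<and> Z \<omega> \<in> B}"
proof -
  let ?T = "restrict_space borel T"
  obtain \<B> :: "'b set set" where \<B>: "countable \<B>" "topological_basis \<B>"
    using ex_countable_basis by blast
  have ne: "\<B> \<noteq> {}" using topological_basisE[OF \<B>(2) open_UNIV UNIV_I] by blast
  define D where "D = from_nat_into \<B>"
  have rD: "range D = \<B>" unfolding D_def by (rule range_from_nat_into[OF ne \<B>(1)])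
  define f where "f = ternary_code D"
  have inj: "inj_on f T" unfolding f_def
  proof (rule inj_on_ternary_code)
    fix s t :: 'b assume "s \<noteq> t"
    then obtain U where U: "open U" "s \<in> U" "t \<notin> U" using t1_space by blast
    then obtain V where "V \<in> \<B>" "s \<in> V" "V \<subseteq> U" using topological_basisE[OF \<B>(2)] by metis
    then have "V \<in> range D" "(s \<in> V) \<noteq> (t \<in> V)" using U rD by auto
    then show "\<exists>k. (s \<in> D k) \<noteq> (t \<in> D k)" by auto
  qed
  have f[measurable]: "f \<in> borel_measurable ?T" unfolding f_def
  proof (rule borel_measurable_ternary_code)
    fix k
    have "D k \<in> \<B>" using rD by auto
    then have "open (D k)" using topological_basis_open[OF \<B>(2)] by blast
    then show "D k \<inter> space ?T \<in> sets ?T" using T by (auto simp: sets_restrict_space_iff space_restrict_space)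
  qed
  have Q: "prob_space (distr M ?T Z)" by (rule prob_space_distr) (rule Z)
  obtain \<psi> where \<psi>[measurable]: "\<psi> \<in> borel \<rightarrow>\<^sub>M ?T" and inv: "AE t in distr M ?T Z. \<psi> (f t) = t"
    by (rule measurable_left_inverse[OF T Q _ f inj]) auto
  have inv': "AE \<omega> in M. \<psi> (f (Z \<omega>)) = Z \<omega>" by (rule AE_distrD[OF Z inv])
  have fZ: "(\<lambda>\<omega>. f (Z \<omega>)) \<in> borel_measurable M" by measurable
  obtain \<kappa> where \<kappa>: "\<kappa> \<in> Y \<rightarrow>\<^sub>M prob_algebra borel" and
    \<kappa>_int: "\<And>A B. A \<in> sets Y \<Longrightarrow> B \<in> sets borel \<Longrightarrow>
      (\<integral>\<^sup>+ y. emeasure (\<kappa> y) B * indicator A y \<partial>distr M Y g) = emeasure M {\<omega> \<in> space M. g \<omega> \<in> A \<and> f (Z \<omega>) \<in> B}"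
    by (rule regular_conditional_distribution_unit_interval[OF g fZ])
       (auto simp: f_def ternary_code_bounds)
  show thesis
  proof (rule that[of "\<lambda>y. distr (\<kappa> y) ?T \<psi>"])
    show "(\<lambda>y. distr (\<kappa> y) ?T \<psi>) \<in> Y \<rightarrow>\<^sub>M prob_algebra ?T"
      by (rule measurable_compose[OF \<kappa> measurable_distr_prob_space[OF \<psi>]])
    fix A B assume A[measurable]: "A \<in> sets Y" and B[measurable]: "B \<in> sets ?T"
    have vB[measurable]: "\<psi> -` B \<in> sets borel" using measurable_sets[OF \<psi> B] by simp
    have "(\<integral>\<^sup>+ y. emeasure (distr (\<kappa> y) ?T \<psi>) B * indicator A y \<partial>distr M Y g)
        = (\<integral>\<^sup>+ y. emeasure (\<kappa> y) (\<psi> -` B) * indicator A y \<partial>distr M Y g)"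
    proof (rule nn_integral_cong)
      fix y assume "y \<in> space (distr M Y g)"
      then have sets: "sets (\<kappa> y) = sets borel"
        using measurable_space[OF \<kappa>, of y] by (simp add: space_prob_algebra)
      then have "space (\<kappa> y) = UNIV" using sets_eq_imp_space_eq[OF sets] by simp
      moreover have "\<psi> \<in> \<kappa> y \<rightarrow>\<^sub>M ?T" unfolding measurable_cong_sets[OF sets refl] by (rule \<psi>)
      ultimately have "emeasure (distr (\<kappa> y) ?T \<psi>) B = emeasure (\<kappa> y) (\<psi> -` B)"
        using emeasure_distr[of \<psi> "\<kappa> y" ?T B] by simp
      then show "emeasure (distr (\<kappa> y) ?T \<psi>) B * indicator A y = emeasure (\<kappa> y) (\<psi> -` B) * indicator A y"
        by simp
    qed
    also have "\<dots> = emeasure M {\<omega> \<in> space M. g \<omega> \<in> A \<and> f (Z \<omega>) \<in> \<psi> -` B}"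
      by (rule \<kappa>_int[OF A vB])
    also have "\<dots> = emeasure M {\<omega> \<in> space M. g \<omega> \<in> A \<and> Z \<omega> \<in> B}"
    proof (rule emeasure_eq_AE)
      show "AE \<omega> in M. (\<omega> \<in> {\<omega> \<in> space M. g \<omega> \<in> A \<and> f (Z \<omega>) \<in> \<psi> -` B})
          = (\<omega> \<in> {\<omega> \<in> space M. g \<omega> \<in> A \<and> Z \<omega> \<in> B})"
        using inv' by eventually_elim auto
    qed measurable
    finally show "(\<integral>\<^sup>+ y. emeasure (distr (\<kappa> y) ?T \<psi>) B * indicator A y \<partial>distr M Y g)
        = emeasure M {\<omega> \<in> space M. g \<omega> \<in> A \<and> Z \<omega> \<in> B}" .
  qed
qed

section \<open>Countable determining classes\<close>

text \<open>
  The finite intersections of the sets of a countable base form a countable generator of the Borel sets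
  that is stable under intersection. Measuring their traces on \<open>X\<close> identifies a probability measure on
  \<open>X\<close>, as one sees from its image in the whole space.
\<close>
lemma countable_measure_determining_class:
  obtains E :: "'a::second_countable_topology set set" where "countable E" "E \<subseteq> sets borel"
    "\<And>X p q. X \<in> sets borel \<Longrightarrow> prob_space p \<Longrightarrow> prob_space q \<Longrightarrow>
       sets p = sets (borel_on X) \<Longrightarrow> sets q = sets (borel_on X) \<Longrightarrow>
       (\<And>U. U \<in> E \<Longrightarrow> measure p (U \<inter> X) = measure q (U \<inter> X)) \<Longrightarrow> p = q"
proof -
  obtain \<B> :: "'a set set" where \<B>: "countable \<B>" "topological_basis \<B>"
    using ex_countable_basis by blast
  define E where "E = Inter ` {S. finite S \<and> S \<subseteq> \<B>}"
  have cE: "countable E" unfolding E_def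
    by (intro countable_image countable_Collect_finite_subset \<B>)
  have \<B>E: "\<B> \<subseteq> E"
  proof
    fix U assume "U \<in> \<B>"
    then show "U \<in> E" unfolding E_def by (intro image_eqI[of _ _ "{U}"]) auto
  qed
  have Eb: "E \<subseteq> sets borel"
  proof
    fix U assume "U \<in> E"
    then obtain S where S: "finite S" "S \<subseteq> \<B>" "U = \<Inter>S" by (auto simp: E_def)
    then have "open U" using topological_basis_open[OF \<B>(2)] by (auto intro!: open_Inter)
    then show "U \<in> sets borel" by simp
  qed
  have gen: "sets borel = sigma_sets UNIV E"
  proof (rule antisym)
    have "sets borel = sigma_sets UNIV \<B>" by (subst borel_eq_countable_basis[OF \<B>]) simp
    also have "\<dots> \<subseteq> sigma_sets UNIV E" by (rule sigma_sets_subseteq[OF \<B>E])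
    finally show "sets borel \<subseteq> sigma_sets UNIV E" .
    show "sigma_sets UNIV E \<subseteq> sets borel" using sets.sigma_sets_subset[OF Eb] by simp
  qed
  have stable: "Int_stable E"
  proof (rule Int_stableI)
    fix U V assume "U \<in> E" "V \<in> E"
    then obtain S T where "finite S" "S \<subseteq> \<B>" "U = \<Inter>S" "finite T" "T \<subseteq> \<B>" "V = \<Inter>T"
      by (auto simp: E_def)
    then show "U \<inter> V \<in> E" unfolding E_def by (intro image_eqI[of _ _ "S \<union> T"]) auto
  qed
  have top: "UNIV \<in> E" unfolding E_def by (intro image_eqI[of _ _ "{}"]) auto
  show thesis
  proof (rule that[OF cE Eb])
    fix X :: "'a set" and p q :: "'a measure"
    assume X: "X \<in> sets borel" and pq: "prob_space p" "prob_space q"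
      and sp: "sets p = sets (borel_on X)" and sq: "sets q = sets (borel_on X)"
      and eq: "\<And>U. U \<in> E \<Longrightarrow> measure p (U \<inter> X) = measure q (U \<inter> X)"
    interpret p: prob_space p by fact
    interpret q: prob_space q by fact
    have "space p = X" "space q = X"
      using sets_eq_imp_space_eq[OF sp] sets_eq_imp_space_eq[OF sq] by (auto simp: space_restrict_space)
    have pm: "(\<lambda>x. x) \<in> p \<rightarrow>\<^sub>M borel" "(\<lambda>x. x) \<in> q \<rightarrow>\<^sub>M borel"
      unfolding measurable_cong_sets[OF sp refl] measurable_cong_sets[OF sq refl]
      by (rule measurable_restrict_space1, simp)+
    have dp: "emeasure (distr p borel (\<lambda>x. x)) U = emeasure p (U \<inter> X)"
      and dq: "emeasure (distr q borel (\<lambda>x. x)) U = emeasure q (U \<inter> X)" if "U \<in> sets borel" for U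
      using that pm \<open>space p = X\<close> \<open>space q = X\<close> by (simp_all add: emeasure_distr)
    have "distr p borel (\<lambda>x. x) = distr q borel (\<lambda>x. x)"
    proof (rule measure_eqI_generator_eq[OF stable _ _ _ _, of UNIV _ _ "\<lambda>_. UNIV"])
      fix U assume "U \<in> E"
      then show "emeasure (distr p borel (\<lambda>x. x)) U = emeasure (distr q borel (\<lambda>x. x)) U"
        using Eb eq[of U] by (subst dp dq, blast)+ (simp add: p.emeasure_eq_measure q.emeasure_eq_measure)
    qed (use top gen in \<open>auto simp: dp\<close>)
    show "p = q"
    proof (rule measure_eqI)
      fix A assume "A \<in> sets p"
      then have A: "A \<in> sets borel" "A \<subseteq> X" using X by (auto simp: sp sets_restrict_space_iff)
      then have "A \<inter> X = A" by auto
      then show "emeasure p A = emeasure q A"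
        using dp[OF A(1)] dq[OF A(1)] \<open>distr p borel _ = _\<close> by simp
    qed (simp add: sp sq)
  qed
qed

section \<open>The joint law of parameter and observations\<close>

locale iid_model =
  fixes X :: "'a::polish_space set" and \<Theta> :: "'b::polish_space set"
    and P :: "'b \<Rightarrow> 'a measure" and prior :: "'b measure"
  assumes X_borel: "X \<in> sets borel" and \<Theta>_borel: "\<Theta> \<in> sets borel"
    and prob_P: "\<theta> \<in> \<Theta> \<Longrightarrow> prob_space (P \<theta>)"
    and sets_P: "\<theta> \<in> \<Theta> \<Longrightarrow> sets (P \<theta>) = sets (borel_on X)"
    and prob_prior: "prob_space prior" and sets_prior: "sets prior = sets (borel_on \<Theta>)"
    and P_measurable: "A \<in> sets (borel_on X) \<Longrightarrow>
           (\<lambda>\<theta>. measure (P \<theta>) A) \<in> borel_measurable (borel_on \<Theta>)"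
begin

abbreviation seq_space :: "(nat \<Rightarrow> 'a) measure" where
  "seq_space \<equiv> (\<Pi>\<^sub>M i\<in>UNIV. borel_on X)"

abbreviation iid :: "'b \<Rightarrow> (nat \<Rightarrow> 'a) measure" where
  "iid \<theta> \<equiv> (\<Pi>\<^sub>M i\<in>UNIV. P \<theta>)"

abbreviation \<mu> :: "((nat \<Rightarrow> 'a) \<times> 'b) measure" where
  "\<mu> \<equiv> joint_measure X \<Theta> P prior"

abbreviation F :: "nat \<Rightarrow> ((nat \<Rightarrow> 'a) \<times> 'b) measure" where
  "F \<equiv> obs_algebra X \<Theta>"

lemma space_prior: "space prior = \<Theta>"
  using sets_eq_imp_space_eq[OF sets_prior] by (simp add: space_restrict_space)

lemma space_P: "\<theta> \<in> \<Theta> \<Longrightarrow> space (P \<theta>) = X"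
  using sets_eq_imp_space_eq[OF sets_P] by (simp add: space_restrict_space)

lemma sets_iid: "\<theta> \<in> \<Theta> \<Longrightarrow> sets (iid \<theta>) = sets seq_space"
  by (intro sets_PiM_cong refl sets_P)

lemma space_iid: "\<theta> \<in> \<Theta> \<Longrightarrow> space (iid \<theta>) = space seq_space"
  by (rule sets_eq_imp_space_eq[OF sets_iid])

lemma prob_iid: "\<theta> \<in> \<Theta> \<Longrightarrow> prob_space (iid \<theta>)"
  by (intro prob_space_PiM prob_P)

lemma space_joint: "space (joint_space X \<Theta>) = space seq_space \<times> \<Theta>"
  by (simp add: joint_space_def space_pair_measure space_restrict_space)

text \<open>
  It suffices to consider cylinder sets, whose probabilities are finite products of values \<open>P \<theta> A\<close>.
\<close>
lemma measurable_iid: "iid \<in> borel_on \<Theta> \<rightarrow>\<^sub>M prob_algebra seq_space"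
proof (rule measurable_prob_algebra_generated[OF sets_PiM Int_stable_prod_algebra prod_algebra_sets_into_space])
  fix \<theta> assume "\<theta> \<in> space (borel_on \<Theta>)"
  then have \<theta>: "\<theta> \<in> \<Theta>" by (simp add: space_restrict_space)
  show "prob_space (iid \<theta>)" "sets (iid \<theta>) = sets seq_space"
    by (rule prob_iid[OF \<theta>], rule sets_iid[OF \<theta>])
next
  fix E assume "E \<in> prod_algebra UNIV (\<lambda>i::nat. borel_on X)"
  then obtain J A where J: "finite J" and A: "\<And>i. i \<in> J \<Longrightarrow> A i \<in> sets (borel_on X)"
    and E: "E = prod_emb UNIV (\<lambda>i. borel_on X) J (\<Pi>\<^sub>E j\<in>J. A j)"
    by (rule prod_algebraE) blast
  have "(\<lambda>\<theta>. \<Prod>i\<in>J. ennreal (measure (P \<theta>) (A i))) \<in> borel_measurable (borel_on \<Theta>)"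
  proof (rule borel_measurable_prod_ennreal)
    fix i assume "i \<in> J"
    then show "(\<lambda>\<theta>. ennreal (measure (P \<theta>) (A i))) \<in> borel_measurable (borel_on \<Theta>)"
      by (intro measurable_compose[OF P_measurable measurable_ennreal] A)
  qed
  also have "?this \<longleftrightarrow> (\<lambda>\<theta>. emeasure (iid \<theta>) E) \<in> borel_measurable (borel_on \<Theta>)"
  proof (rule measurable_cong)
    fix \<theta> assume "\<theta> \<in> space (borel_on \<Theta>)"
    then have \<theta>: "\<theta> \<in> \<Theta>" by (simp add: space_restrict_space)
    interpret p: prob_space "P \<theta>" by (rule prob_P[OF \<theta>])
    have "E = prod_emb UNIV (\<lambda>i. P \<theta>) J (\<Pi>\<^sub>E j\<in>J. A j)"
      unfolding E prod_emb_def by (simp add: space_P[OF \<theta>] space_restrict_space)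
    then have "emeasure (iid \<theta>) E = (\<Prod>i\<in>J. emeasure (P \<theta>) (A i))"
      using emeasure_PiM_emb[of UNIV "\<lambda>_. P \<theta>" J A] J A sets_P[OF \<theta>] prob_P[OF \<theta>] by simp
    then show "(\<Prod>i\<in>J. ennreal (measure (P \<theta>) (A i))) = emeasure (iid \<theta>) E"
      by (simp add: p.emeasure_eq_measure)
  qed
  finally show "(\<lambda>\<theta>. emeasure (iid \<theta>) E) \<in> borel_measurable (borel_on \<Theta>)" .
qed

text \<open>
  The law of observations and parameter when the parameter is known. It is a measure on the product
  space so that \<open>\<mu>\<close> becomes a bind in the Giry monad, which shows at once that the set function
  in the definition of \<open>joint_measure\<close> is countably additive.
\<close>
definition joint_kernel :: "'b \<Rightarrow> ((nat \<Rightarrow> 'a) \<times> 'b) measure" where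
  "joint_kernel \<theta> = distr (iid \<theta>) (joint_space X \<Theta>) (\<lambda>x. (x, \<theta>))"

lemma measurable_joint_kernel: "joint_kernel \<in> borel_on \<Theta> \<rightarrow>\<^sub>M prob_algebra (joint_space X \<Theta>)"
  unfolding joint_kernel_def
  by (rule measurable_distr_prob_space2[OF measurable_iid]) (simp add: joint_space_def)

lemma pair_measurable: "\<theta> \<in> \<Theta> \<Longrightarrow> (\<lambda>x. (x, \<theta>)) \<in> iid \<theta> \<rightarrow>\<^sub>M joint_space X \<Theta>"
  unfolding measurable_cong_sets[OF sets_iid refl] joint_space_def
  by (rule measurable_Pair) (auto simp: space_restrict_space)

lemma emeasure_joint_kernel:
  assumes \<theta>: "\<theta> \<in> \<Theta>" and E: "E \<in> sets (joint_space X \<Theta>)"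
  shows "emeasure (joint_kernel \<theta>) E = emeasure (iid \<theta>) ((\<lambda>x. (x, \<theta>)) -` E)"
proof -
  have "(\<lambda>x. (x, \<theta>)) -` E \<inter> space (iid \<theta>) = (\<lambda>x. (x, \<theta>)) -` E"
    using sets.sets_into_space[OF E] by (auto simp: space_joint space_iid[OF \<theta>])
  then show ?thesis
    unfolding joint_kernel_def emeasure_distr[OF pair_measurable[OF \<theta>] E] by simp
qed

lemma prior_in_prob_algebra: "prior \<in> space (prob_algebra (borel_on \<Theta>))"
  by (simp add: space_prob_algebra prob_prior sets_prior)

lemma joint_measure_eq_bind: "\<mu> = prior \<bind> joint_kernel"
proof -
  let ?B = "prior \<bind> joint_kernel" and ?J = "joint_space X \<Theta>"
  have sets: "sets ?B = sets ?J" by (rule sets_bind'[OF prior_in_prob_algebra measurable_joint_kernel])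
  have "\<mu> = measure_of (space ?J) (sets ?J) (emeasure ?B)"
    unfolding joint_measure_def
  proof (rule measure_of_eq[OF sets.space_closed])
    fix E assume "E \<in> sigma_sets (space ?J) (sets ?J)"
    then have E: "E \<in> sets ?J" by (simp add: sets.sigma_sets_eq)
    show "(\<integral>\<^sup>+ t. emeasure (iid t) ((\<lambda>x. (x, t)) -` E) \<partial>prior) = emeasure ?B E"
      unfolding emeasure_bind_prob_algebra[OF prior_in_prob_algebra measurable_joint_kernel E]
      by (rule nn_integral_cong) (simp add: space_prior emeasure_joint_kernel[OF _ E])
  qed
  also have "\<dots> = ?B"
    using measure_of_of_measure[of ?B] sets sets_eq_imp_space_eq[OF sets] by simp
  finally show ?thesis .
qed

lemma sets_\<mu>[measurable_cong]: "sets \<mu> = sets (joint_space X \<Theta>)"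
  unfolding joint_measure_eq_bind by (rule sets_bind'[OF prior_in_prob_algebra measurable_joint_kernel])

lemma space_\<mu>: "space \<mu> = space seq_space \<times> \<Theta>"
  using sets_eq_imp_space_eq[OF sets_\<mu>] by (simp add: space_joint)

lemma prob_\<mu>: "prob_space \<mu>"
  unfolding joint_measure_eq_bind by (rule prob_space_bind'[OF prior_in_prob_algebra measurable_joint_kernel])

sublocale \<mu>: prob_space \<mu> by (rule prob_\<mu>)
sublocale prior: prob_space prior by (rule prob_prior)

lemma emeasure_\<mu>:
  assumes "E \<in> sets \<mu>"
  shows "emeasure \<mu> E = (\<integral>\<^sup>+ \<theta>. emeasure (iid \<theta>) ((\<lambda>x. (x, \<theta>)) -` E) \<partial>prior)"
proof -
  have E: "E \<in> sets (joint_space X \<Theta>)" using assms sets_\<mu> by simp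
  show ?thesis
    unfolding joint_measure_eq_bind
      emeasure_bind_prob_algebra[OF prior_in_prob_algebra measurable_joint_kernel E]
    by (rule nn_integral_cong) (simp add: space_prior emeasure_joint_kernel[OF _ E])
qed

lemma snd_measurable[measurable]: "snd \<in> \<mu> \<rightarrow>\<^sub>M borel_on \<Theta>"
  unfolding measurable_cong_sets[OF sets_\<mu> refl] joint_space_def by simp

lemma fst_measurable[measurable]: "fst \<in> \<mu> \<rightarrow>\<^sub>M seq_space"
  unfolding measurable_cong_sets[OF sets_\<mu> refl] joint_space_def by simp

text \<open>
  What holds for almost every pair holds, for almost every parameter, almost surely under the
  observations from that parameter. This transfers convergence from \<open>\<mu>\<close> to the sampling
  distributions.
\<close>
lemma AE_section:
  assumes "AE \<omega> in \<mu>. Q \<omega>"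
  shows "AE \<theta> in prior. AE x in iid \<theta>. Q (x, \<theta>)"
proof -
  from assms obtain N where N: "{\<omega> \<in> space \<mu>. \<not> Q \<omega>} \<subseteq> N" "emeasure \<mu> N = 0" "N \<in> sets \<mu>"
    by (rule AE_E)
  have NJ: "N \<in> sets (joint_space X \<Theta>)" using N(3) sets_\<mu> by simp
  have "AE \<omega> in prior \<bind> joint_kernel. \<omega> \<notin> N"
    unfolding joint_measure_eq_bind[symmetric] by (rule AE_not_in) (simp add: null_sets_def N)
  then have "AE \<theta> in prior. AE \<omega> in joint_kernel \<theta>. \<omega> \<notin> N"
  proof (subst (asm) AE_bind)
    show "joint_kernel \<in> prior \<rightarrow>\<^sub>M subprob_algebra (joint_space X \<Theta>)"
      unfolding measurable_cong_sets[OF sets_prior refl]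
      by (rule measurable_prob_algebraD[OF measurable_joint_kernel])
    show "Measurable.pred (joint_space X \<Theta>) (\<lambda>\<omega>. \<omega> \<notin> N)" using NJ by measurable
  qed
  then show ?thesis using AE_space
  proof eventually_elim
    case (elim \<theta>)
    then have \<theta>: "\<theta> \<in> \<Theta>" by (simp add: space_prior)
    have "AE x in iid \<theta>. (x, \<theta>) \<notin> N"
      using elim(1) unfolding joint_kernel_def by (rule AE_distrD[OF pair_measurable[OF \<theta>]])
    then show ?case using AE_space
      by eventually_elim (use N(1) \<theta> in \<open>auto simp: space_\<mu> space_iid[OF \<theta>]\<close>)
  qed
qed

lemma distr_snd: "distr \<mu> (borel_on \<Theta>) snd = prior"
proof (rule measure_eqI)
  fix B assume "B \<in> sets (distr \<mu> (borel_on \<Theta>) snd)"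
  then have B: "B \<in> sets (borel_on \<Theta>)" by simp
  have B\<Theta>: "B \<subseteq> \<Theta>" using sets.sets_into_space[OF B] by (simp add: space_restrict_space)
  have m: "snd -` B \<inter> space \<mu> \<in> sets \<mu>" using B by measurable
  have "emeasure (distr \<mu> (borel_on \<Theta>) snd) B = emeasure \<mu> (snd -` B \<inter> space \<mu>)"
    using B by (subst emeasure_distr) auto
  also have "\<dots> = (\<integral>\<^sup>+ \<theta>. indicator B \<theta> \<partial>prior)"
    unfolding emeasure_\<mu>[OF m]
  proof (rule nn_integral_cong)
    fix \<theta> assume "\<theta> \<in> space prior"
    then have \<theta>: "\<theta> \<in> \<Theta>" by (simp add: space_prior)
    have "(\<lambda>x. (x, \<theta>)) -` (snd -` B \<inter> space \<mu>) = (if \<theta> \<in> B then space (iid \<theta>) else {})"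
      using \<theta> by (auto simp: space_\<mu> space_iid[OF \<theta>])
    then show "emeasure (iid \<theta>) ((\<lambda>x. (x, \<theta>)) -` (snd -` B \<inter> space \<mu>)) = indicator B \<theta>"
      using prob_space.emeasure_space_1[OF prob_iid[OF \<theta>]] by simp
  qed
  also have "\<dots> = emeasure prior B" using B sets_prior by simp
  finally show "emeasure (distr \<mu> (borel_on \<Theta>) snd) B = emeasure prior B" .
qed (simp add: sets_prior)

lemma first_obs_measurable[measurable]:
  "(\<lambda>\<omega>. first_obs n (fst \<omega>)) \<in> \<mu> \<rightarrow>\<^sub>M (\<Pi>\<^sub>M i\<in>{..<n}. borel_on X)"
  unfolding first_obs_def
  by (rule measurable_compose[OF fst_measurable measurable_restrict_subset]) simp

lemma space_F: "space (F n) = space \<mu>"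
  by (simp add: obs_algebra_def space_\<mu> space_joint)

lemma first_obs_measurable_F:
  "(\<lambda>\<omega>. first_obs n (fst \<omega>)) \<in> F n \<rightarrow>\<^sub>M (\<Pi>\<^sub>M i\<in>{..<n}. borel_on X)"
  unfolding obs_algebra_def
proof (rule measurable_vimage_algebra1)
  show "(\<lambda>\<omega>. first_obs n (fst \<omega>)) \<in> space (joint_space X \<Theta>) \<rightarrow> space (\<Pi>\<^sub>M i\<in>{..<n}. borel_on X)"
    using measurable_space[OF first_obs_measurable] by (auto simp: space_\<mu> space_joint)
qed

lemma subalgebra_F: "subalgebra \<mu> (F n)"
  unfolding subalgebra_def
proof
  show "sets (F n) \<subseteq> sets \<mu>" unfolding obs_algebra_def
    by (rule sets_image_in_sets[OF _ first_obs_measurable]) (simp add: space_\<mu> space_joint)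
qed (rule space_F)

lemma sets_F_mono: "m \<le> n \<Longrightarrow> sets (F m) \<subseteq> sets (F n)"
  unfolding obs_algebra_def[of X \<Theta> m]
proof (rule sets_image_in_sets)
  show "space (F n) = space (joint_space X \<Theta>)" by (simp add: space_F space_\<mu> space_joint)
  assume "m \<le> n"
  then have "(\<lambda>\<omega>. restrict (first_obs n (fst \<omega>)) {..<m}) \<in> F n \<rightarrow>\<^sub>M (\<Pi>\<^sub>M i\<in>{..<m}. borel_on X)"
    by (intro measurable_compose[OF first_obs_measurable_F measurable_restrict_subset]) auto
  also have "(\<lambda>\<omega>. restrict (first_obs n (fst \<omega>)) {..<m}) = (\<lambda>\<omega>. first_obs m (fst \<omega>))"
    using \<open>m \<le> n\<close> by (auto simp: first_obs_def fun_eq_iff restrict_def)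
  finally show "(\<lambda>\<omega>. first_obs m (fst \<omega>)) \<in> F n \<rightarrow>\<^sub>M (\<Pi>\<^sub>M i\<in>{..<m}. borel_on X)" .
qed

lemma observation_measurable_F: "i < n \<Longrightarrow> (\<lambda>\<omega>. fst \<omega> i) \<in> F n \<rightarrow>\<^sub>M borel_on X"
proof -
  assume i: "i < n"
  have "(\<lambda>\<omega>. first_obs n (fst \<omega>) i) \<in> F n \<rightarrow>\<^sub>M borel_on X"
    by (rule measurable_compose[OF first_obs_measurable_F measurable_component_singleton]) (simp add: i)
  then show ?thesis using i by (simp add: first_obs_def)
qed

section \<open>The observations determine the parameter\<close>

definition empirical :: "'a set \<Rightarrow> nat \<Rightarrow> (nat \<Rightarrow> 'a) \<Rightarrow> real" where
  "empirical A n x = (\<Sum>i<n. indicator A (x i)) / n"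

text \<open>
  Hoeffding's inequality. The bound does not depend on \<open>\<theta>\<close>, so it can be integrated over the prior.
\<close>
lemma empirical_deviation:
  assumes \<theta>: "\<theta> \<in> \<Theta>" and A: "A \<in> sets (borel_on X)" and d: "0 \<le> d" and n: "0 < n"
  shows "measure (iid \<theta>) {x \<in> space (iid \<theta>). d \<le> \<bar>empirical A n x - measure (P \<theta>) A\<bar>}
      \<le> 2 * exp (- 2 * n * d\<^sup>2)"
proof -
  have [measurable]: "A \<in> sets (P \<theta>)" using A sets_P[OF \<theta>] by simp
  interpret p: prob_space "P \<theta>" by (rule prob_P[OF \<theta>])
  interpret product_prob_space "\<lambda>_. P \<theta>" "UNIV :: nat set" by unfold_locales
  have "P.indep_vars (\<lambda>_. P \<theta>) (\<lambda>i x. x i) {..<n}"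
  proof (subst P.indep_vars_iff_distr_eq_PiM')
    have "distr (iid \<theta>) (\<Pi>\<^sub>M i\<in>{..<n}. P \<theta>) (\<lambda>x. restrict x {..<n}) = (\<Pi>\<^sub>M i\<in>{..<n}. P \<theta>)"
      by (rule distr_PiM_restrict_finite) auto
    also have "\<dots> = (\<Pi>\<^sub>M i\<in>{..<n}. distr (iid \<theta>) (P \<theta>) (\<lambda>x. x i))"
      by (intro PiM_cong refl PiM_component[symmetric]) simp
    finally show "distr (iid \<theta>) (\<Pi>\<^sub>M i\<in>{..<n}. P \<theta>) (\<lambda>x. \<lambda>i\<in>{..<n}. x i)
        = (\<Pi>\<^sub>M i\<in>{..<n}. distr (iid \<theta>) (P \<theta>) (\<lambda>x. x i))" by (simp add: restrict_def)
  qed (use n in auto)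
  then have ind: "P.indep_vars (\<lambda>_. borel) (\<lambda>i x. indicator A (x i) :: real) {..<n}"
    by (rule P.indep_vars_compose2) measurable
  have D: "distr (iid \<theta>) borel (\<lambda>x. indicator A (x i) :: real) = distr (P \<theta>) borel (indicator A)" for i
  proof -
    have "distr (P \<theta>) borel (indicator A :: _ \<Rightarrow> real) = distr (distr (iid \<theta>) (P \<theta>) (\<lambda>x. x i)) borel (indicator A)"
      by (simp add: PiM_component)
    also have "\<dots> = distr (iid \<theta>) borel (indicator A \<circ> (\<lambda>x. x i))"
      by (rule distr_distr) measurable
    finally show ?thesis by (simp add: comp_def)
  qed
  have mean: "P.expectation (\<lambda>x. indicator A (x 0) :: real) = measure (P \<theta>) A"
  proof -
    have "P.expectation (\<lambda>x. indicator A (x 0) :: real) = (\<integral>y. y \<partial>distr (iid \<theta>) borel (\<lambda>x. indicator A (x 0)))"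
      by (rule integral_distr[symmetric]) measurable
    also have "\<dots> = (\<integral>x. indicator A x \<partial>P \<theta>)" unfolding D by (rule integral_distr) measurable
    finally show ?thesis by simp
  qed
  interpret H: Hoeffding_ineq_iid "iid \<theta>" "{..<n}" "\<lambda>i x. indicator A (x i)" "\<lambda>x. indicator A (x 0)" 0 1
    "measure (P \<theta>) A"
  proof unfold_locales
    show "finite {..<n}" by simp
    show "P.indep_vars (\<lambda>_. borel) (\<lambda>i x. indicator A (x i) :: real) {..<n}" by (rule ind)
    show "distr (iid \<theta>) borel (\<lambda>x. indicator A (x i) :: real) = distr (iid \<theta>) borel (\<lambda>x. indicator A (x 0))" for i
      unfolding D ..
    show "(\<lambda>x. indicator A (x 0) :: real) \<in> borel_measurable (iid \<theta>)" by measurable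
    show "AE x in iid \<theta>. indicator A (x 0) \<in> {0..1::real}" by (rule AE_I2) (simp split: split_indicator)
    show "measure (P \<theta>) A \<equiv> P.expectation (\<lambda>x. indicator A (x 0))"
      by (rule eq_reflection[OF mean[symmetric]])
  qed
  show ?thesis using H.Hoeffding_ineq_abs_ge'[of d] d n
    by (simp add: empirical_def lessThan_empty_iff)
qed

lemma likelihood_measurable[measurable]:
  "A \<in> sets (borel_on X) \<Longrightarrow> (\<lambda>\<omega>. measure (P (snd \<omega>)) A) \<in> borel_measurable \<mu>"
  by (rule measurable_compose[OF snd_measurable P_measurable])

lemma empirical_measurable_F:
  assumes A: "A \<in> sets (borel_on X)"
  shows "(\<lambda>\<omega>. empirical A n (fst \<omega>)) \<in> borel_measurable (F n)"
  unfolding empirical_def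
proof (intro borel_measurable_divide borel_measurable_sum borel_measurable_const)
  fix i assume "i \<in> {..<n}"
  then show "(\<lambda>\<omega>. indicator A (fst \<omega> i) :: real) \<in> borel_measurable (F n)"
    using A by (intro measurable_compose[OF observation_measurable_F borel_measurable_indicator]) auto
qed

lemma empirical_converges:
  assumes A: "A \<in> sets (borel_on X)" and d: "0 < d"
  shows "(\<lambda>n. \<mu>.prob {\<omega> \<in> space \<mu>. d \<le> \<bar>empirical A n (fst \<omega>) - measure (P (snd \<omega>)) A\<bar>}) \<longlonglongrightarrow> 0"
proof (rule tendsto_sandwich[OF _ _ tendsto_const])
  show "(\<lambda>n. 2 * exp (- 2 * d\<^sup>2) ^ n) \<longlonglongrightarrow> 0"
    using d by (intro tendsto_mult_right_zero LIMSEQ_realpow_zero) auto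
  have "\<mu>.prob {\<omega> \<in> space \<mu>. d \<le> \<bar>empirical A n (fst \<omega>) - measure (P (snd \<omega>)) A\<bar>} \<le> 2 * exp (- 2 * d\<^sup>2) ^ n"
    if n: "0 < n" for n
  proof -
    let ?E = "{\<omega> \<in> space \<mu>. d \<le> \<bar>empirical A n (fst \<omega>) - measure (P (snd \<omega>)) A\<bar>}"
    have [measurable]: "(\<lambda>\<omega>. empirical A n (fst \<omega>)) \<in> borel_measurable \<mu>"
      by (rule measurable_from_subalg[OF subalgebra_F empirical_measurable_F[OF A]])
    note A[measurable]
    have E: "?E \<in> sets \<mu>" by measurable
    have "emeasure \<mu> ?E \<le> (\<integral>\<^sup>+ \<theta>. ennreal (2 * exp (- 2 * n * d\<^sup>2)) \<partial>prior)"
      unfolding emeasure_\<mu>[OF E]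
    proof (rule nn_integral_mono)
      fix \<theta> assume "\<theta> \<in> space prior"
      then have \<theta>: "\<theta> \<in> \<Theta>" by (simp add: space_prior)
      interpret p: prob_space "iid \<theta>" by (rule prob_iid[OF \<theta>])
      have "(\<lambda>x. (x, \<theta>)) -` ?E = {x \<in> space (iid \<theta>). d \<le> \<bar>empirical A n x - measure (P \<theta>) A\<bar>}"
        using \<theta> by (auto simp: space_\<mu> space_iid[OF \<theta>])
      then show "emeasure (iid \<theta>) ((\<lambda>x. (x, \<theta>)) -` ?E) \<le> ennreal (2 * exp (- 2 * n * d\<^sup>2))"
        using empirical_deviation[OF \<theta> A _ n, of d] d by (simp add: p.emeasure_eq_measure ennreal_leI)
    qed
    also have "\<dots> = ennreal (2 * exp (- 2 * n * d\<^sup>2))" by (simp add: prior.emeasure_space_1)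
    finally have "\<mu>.prob ?E \<le> 2 * exp (- 2 * n * d\<^sup>2)" by (simp add: \<mu>.emeasure_eq_measure)
    also have "\<dots> = 2 * exp (- 2 * d\<^sup>2) ^ n" by (simp add: exp_of_nat_mult[symmetric] mult_ac)
    finally show ?thesis .
  qed
  then show "eventually (\<lambda>n. \<mu>.prob {\<omega> \<in> space \<mu>. d \<le> \<bar>empirical A n (fst \<omega>) - measure (P (snd \<omega>)) A\<bar>}
      \<le> 2 * exp (- 2 * d\<^sup>2) ^ n) sequentially"
    by (intro eventually_sequentiallyI[of 1]) auto
qed simp

lemma likelihood_superlevel_limit_event:
  assumes "A \<in> sets (borel_on X)"
  shows "{\<omega> \<in> space \<mu>. c < measure (P (snd \<omega>)) A} \<in> limit_events \<mu> F"
  by (rule \<mu>.superlevel_set_limit_event[OF subalgebra_F empirical_measurable_F[OF assms]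
        likelihood_measurable[OF assms] empirical_converges[OF assms]])

text \<open>
  The events \<open>P \<theta> (U \<inter> X) > q\<close>, with \<open>U\<close> in a countable determining class and \<open>q\<close> rational, are
  countably many limit events, and by identifiability they separate the parameters. Their ternary code
  \<open>f\<close> is thus injective, and \<open>f \<theta>\<close> is measurable for the \<open>\<sigma>\<close>-algebra of limit events. A left inverse
  \<open>g\<close> turns \<open>\<theta> \<in> B\<close> into \<open>g (f \<theta>) \<in> B\<close> almost surely.
\<close>
lemma parameter_limit_event:
  assumes inj: "\<And>\<theta> \<theta>'. \<theta> \<in> \<Theta> \<Longrightarrow> \<theta>' \<in> \<Theta> \<Longrightarrow> \<theta> \<noteq> \<theta>' \<Longrightarrow> P \<theta> \<noteq> P \<theta>'"
    and B: "B \<in> sets (borel_on \<Theta>)"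
  shows "{\<omega> \<in> space \<mu>. snd \<omega> \<in> B} \<in> limit_events \<mu> F"
proof -
  obtain E :: "'a set set" where E: "countable E" "E \<subseteq> sets borel"
    "\<And>X p q. X \<in> sets borel \<Longrightarrow> prob_space p \<Longrightarrow> prob_space q \<Longrightarrow>
       sets p = sets (borel_on X) \<Longrightarrow> sets q = sets (borel_on X) \<Longrightarrow>
       (\<And>U. U \<in> E \<Longrightarrow> measure p (U \<inter> X) = measure q (U \<inter> X)) \<Longrightarrow> p = q"
    by (rule countable_measure_determining_class) blast
  have EX: "U \<inter> X \<in> sets (borel_on X)" if "U \<in> E" for U
    using that E(2) X_borel by (auto simp: sets_restrict_space_iff)
  define \<D> where "\<D> = (\<lambda>(U, q). {\<theta> \<in> \<Theta>. q < measure (P \<theta>) (U \<inter> X)}) ` (E \<times> \<rat>)"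
  \<comment> \<open>The empty set is added only to make the family nonempty, so that it can be
    enumerated.\<close>
  define D where "D = from_nat_into (insert {} \<D>)"
  have "countable \<D>" unfolding \<D>_def by (intro countable_image countable_SIGMA E countable_rat)
  then have rD: "range D = insert {} \<D>" unfolding D_def by (intro range_from_nat_into) auto
  define f where "f = ternary_code D"
  have inj_f: "inj_on f \<Theta>" unfolding f_def
  proof (rule inj_on_ternary_code)
    fix s t assume st: "s \<in> \<Theta>" "t \<in> \<Theta>" "s \<noteq> t"
    have "\<exists>U\<in>E. measure (P s) (U \<inter> X) \<noteq> measure (P t) (U \<inter> X)"
    proof (rule ccontr)
      assume "\<not> (\<exists>U\<in>E. measure (P s) (U \<inter> X) \<noteq> measure (P t) (U \<inter> X))"
      then have "P s = P t"
        using st by (intro E(3)[OF X_borel]) (auto simp: prob_P sets_P)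
      then show False using inj[OF st] by simp
    qed
    then obtain U where U: "U \<in> E" "measure (P s) (U \<inter> X) \<noteq> measure (P t) (U \<inter> X)" by blast
    have rat: "\<exists>q\<in>\<rat>. q < a \<longleftrightarrow> \<not> q < b" if "a \<noteq> b" for a b :: real
    proof (cases "a < b")
      case True
      then show ?thesis using Rats_dense_in_real[of a b] by (auto intro: less_asym)
    next
      case False
      then have "b < a" using that by simp
      then show ?thesis using Rats_dense_in_real[of b a] by (auto intro: less_asym)
    qed
    obtain q where q: "q \<in> \<rat>" "q < measure (P s) (U \<inter> X) \<longleftrightarrow> \<not> q < measure (P t) (U \<inter> X)"
      using rat[OF U(2)] by blast
    have "{\<theta> \<in> \<Theta>. q < measure (P \<theta>) (U \<inter> X)} \<in> range D"
      unfolding rD \<D>_def using U(1) q(1) by blast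
    then obtain k where "D k = {\<theta> \<in> \<Theta>. q < measure (P \<theta>) (U \<inter> X)}" by (auto simp only: image_iff)
    then show "\<exists>k. (s \<in> D k) \<noteq> (t \<in> D k)" using st q by (intro exI[of _ k]) auto
  qed
  interpret L: sigma_algebra "space \<mu>" "limit_events \<mu> F"
    by (rule \<mu>.sigma_algebra_limit_events[OF subalgebra_F sets_F_mono])
  define L where "L = sigma (space \<mu>) (limit_events \<mu> F)"
  have L: "space L = space \<mu>" "sets L = limit_events \<mu> F"
    using L.space_closed by (simp_all add: L_def L.sigma_sets_eq space_measure_of_conv)
  have Dk: "snd -` D k \<inter> space \<mu> \<in> limit_events \<mu> F" for k
  proof -
    have "D k \<in> insert {} \<D>" using rD by auto
    then consider "D k = {}" | U q where "U \<in> E" "D k = {\<theta> \<in> \<Theta>. q < measure (P \<theta>) (U \<inter> X)}"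
      by (auto simp: \<D>_def)
    then show ?thesis
    proof cases
      case 1 then show ?thesis by simp
    next
      case 2
      then have "snd -` D k \<inter> space \<mu> = {\<omega> \<in> space \<mu>. q < measure (P (snd \<omega>)) (U \<inter> X)}"
        by (auto simp: space_\<mu>)
      then show ?thesis using likelihood_superlevel_limit_event[OF EX[OF 2(1)]] by simp
    qed
  qed
  have "ternary_code (\<lambda>k. snd -` D k) \<in> borel_measurable L"
    by (rule borel_measurable_ternary_code) (simp add: L Dk)
  also have "ternary_code (\<lambda>k. snd -` D k) = (\<lambda>\<omega>. f (snd \<omega>))"
    by (simp add: f_def ternary_code_def fun_eq_iff indicator_def)
  finally have fL: "(\<lambda>\<omega>. f (snd \<omega>)) \<in> borel_measurable L" .
  have f: "f \<in> borel_measurable (borel_on \<Theta>)"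
    unfolding f_def
  proof (rule borel_measurable_ternary_code)
    fix k
    have "D k \<in> insert {} \<D>" using rD by auto
    then consider "D k = {}" | U q where "U \<in> E" "D k = {\<theta> \<in> \<Theta>. q < measure (P \<theta>) (U \<inter> X)}"
      by (auto simp: \<D>_def)
    then show "D k \<inter> space (borel_on \<Theta>) \<in> sets (borel_on \<Theta>)"
    proof cases
      case 2
      have "{\<theta> \<in> space (borel_on \<Theta>). q < measure (P \<theta>) (U \<inter> X)} \<in> sets (borel_on \<Theta>)"
        using P_measurable[OF EX[OF 2(1)]] by measurable
      then show ?thesis by (simp add: 2 space_restrict_space Int_def conj_commute)
    qed simp
  qed
  obtain g where g: "g \<in> borel \<rightarrow>\<^sub>M borel_on \<Theta>" and gf: "AE \<theta> in prior. g (f \<theta>) = \<theta>"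
    by (rule measurable_left_inverse[OF \<Theta>_borel prob_prior sets_prior f inj_f])
  have gf': "AE \<omega> in \<mu>. g (f (snd \<omega>)) = snd \<omega>"
  proof (rule AE_distrD[OF snd_measurable])
    show "AE \<theta> in distr \<mu> (borel_on \<Theta>) snd. g (f \<theta>) = \<theta>" unfolding distr_snd by (rule gf)
  qed
  have "(\<lambda>\<omega>. f (snd \<omega>)) -` (g -` B \<inter> space borel) \<inter> space L \<in> sets L"
    by (rule measurable_sets[OF fL measurable_sets[OF g B]])
  then have "{\<omega> \<in> space \<mu>. g (f (snd \<omega>)) \<in> B} \<in> limit_events \<mu> F"
    by (simp add: L vimage_def Int_def conj_commute)
  then show ?thesis
  proof (rule \<mu>.null_modification_limit_events[OF _ _ _ subalgebra_F])
    show "{\<omega> \<in> space \<mu>. snd \<omega> \<in> B} \<in> sets \<mu>" using B by measurable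
    show "AE \<omega> in \<mu>. (\<omega> \<in> {\<omega> \<in> space \<mu>. g (f (snd \<omega>)) \<in> B}) = (\<omega> \<in> {\<omega> \<in> space \<mu>. snd \<omega> \<in> B})"
      using gf' by eventually_elim auto
  qed
qed

section \<open>Existence and consistency of posteriors\<close>

lemma finite_subalgebra_F: "finite_measure_subalgebra \<mu> (F n)"
  by (intro finite_measure_subalgebra.intro finite_measure_subalgebra_axioms.intro subalgebra_F)
     unfold_locales

text \<open>
  The events of \<open>F n\<close> are the preimages of measurable sets under the first \<open>n\<close> observations, so the
  defining integrals of the conditional distribution given these observations are those that
  characterize the conditional expectation given \<open>F n\<close>.
\<close>
lemma posterior_exists: "\<exists>post. is_posterior X \<Theta> P prior post"
proof -
  have "\<exists>\<kappa>. \<kappa> \<in> (\<Pi>\<^sub>M i\<in>{..<n}. borel_on X) \<rightarrow>\<^sub>M prob_algebra (borel_on \<Theta>) \<and>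
      (\<forall>B\<in>sets (borel_on \<Theta>). AE \<omega> in \<mu>. measure (\<kappa> (first_obs n (fst \<omega>))) B =
        real_cond_exp \<mu> (F n) (\<lambda>\<omega>. indicator B (snd \<omega>)) \<omega>)" for n
  proof -
    let ?Y = "\<Pi>\<^sub>M i\<in>{..<n}. borel_on X" and ?g = "\<lambda>\<omega>. first_obs n (fst \<omega>)"
    interpret G: finite_measure_subalgebra \<mu> "F n" by (rule finite_subalgebra_F)
    obtain \<kappa> where \<kappa>: "\<kappa> \<in> ?Y \<rightarrow>\<^sub>M prob_algebra (borel_on \<Theta>)" and
      int: "\<And>A B. A \<in> sets ?Y \<Longrightarrow> B \<in> sets (borel_on \<Theta>) \<Longrightarrow>
        (\<integral>\<^sup>+ y. emeasure (\<kappa> y) B * indicator A y \<partial>distr \<mu> ?Y ?g) =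
          emeasure \<mu> {\<omega> \<in> space \<mu>. ?g \<omega> \<in> A \<and> snd \<omega> \<in> B}"
      by (rule \<mu>.regular_conditional_distribution[OF first_obs_measurable \<Theta>_borel snd_measurable]) blast
    have "AE \<omega> in \<mu>. real_cond_exp \<mu> (F n) (\<lambda>\<omega>. indicator B (snd \<omega>)) \<omega> = measure (\<kappa> (?g \<omega>)) B"
      if B[measurable]: "B \<in> sets (borel_on \<Theta>)" for B
    proof (rule G.real_cond_exp_charact)
      have \<kappa>B[measurable]: "(\<lambda>y. measure (\<kappa> y) B) \<in> borel_measurable ?Y"
        by (rule measurable_compose[OF \<kappa> measurable_measure_prob_algebra[OF B]])
      have \<kappa>p: "prob_space (\<kappa> (?g \<omega>))" if "\<omega> \<in> space \<mu>" for \<omega>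
        using measurable_space[OF \<kappa> measurable_space[OF first_obs_measurable that]]
        by (simp add: space_prob_algebra)
      show "integrable \<mu> (\<lambda>\<omega>. indicator B (snd \<omega>) :: real)"
        by (rule \<mu>.integrable_const_bound[of _ 1]) auto
      show "integrable \<mu> (\<lambda>\<omega>. measure (\<kappa> (?g \<omega>)) B)"
        by (rule \<mu>.integrable_const_bound[of _ 1])
           (auto intro!: AE_I2 prob_space.prob_le_1 \<kappa>p)
      show "(\<lambda>\<omega>. measure (\<kappa> (?g \<omega>)) B) \<in> borel_measurable (F n)"
        by (rule measurable_compose[OF first_obs_measurable_F \<kappa>B])
      fix C assume "C \<in> sets (F n)"
      moreover have "?g \<in> space (joint_space X \<Theta>) \<rightarrow> space ?Y"
        using measurable_space[OF first_obs_measurable] by (auto simp: space_\<mu> space_joint)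
      ultimately obtain A where A[measurable]: "A \<in> sets ?Y" and C: "C = ?g -` A \<inter> space \<mu>"
        by (auto simp: obs_algebra_def sets_vimage_algebra2 space_\<mu> space_joint)
      have "(\<integral>\<omega>\<in>C. measure (\<kappa> (?g \<omega>)) B \<partial>\<mu>) = enn2real (\<integral>\<^sup>+ \<omega>. ennreal (indicator C \<omega> * measure (\<kappa> (?g \<omega>)) B) \<partial>\<mu>)"
        unfolding set_lebesgue_integral_def real_scaleR_def
        by (rule integral_eq_nn_integral) (auto simp: C)
      also have "(\<integral>\<^sup>+ \<omega>. ennreal (indicator C \<omega> * measure (\<kappa> (?g \<omega>)) B) \<partial>\<mu>)
          = (\<integral>\<^sup>+ \<omega>. (\<lambda>y. ennreal (measure (\<kappa> y) B) * indicator A y) (?g \<omega>) \<partial>\<mu>)"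
        by (rule nn_integral_cong) (auto simp: C indicator_def)
      also have "\<dots> = (\<integral>\<^sup>+ y. ennreal (measure (\<kappa> y) B) * indicator A y \<partial>distr \<mu> ?Y ?g)"
        by (rule nn_integral_distr[symmetric]) measurable
      also have "\<dots> = (\<integral>\<^sup>+ y. emeasure (\<kappa> y) B * indicator A y \<partial>distr \<mu> ?Y ?g)"
      proof (rule nn_integral_cong)
        fix y assume "y \<in> space (distr \<mu> ?Y ?g)"
        then interpret k: prob_space "\<kappa> y"
          using measurable_space[OF \<kappa>, of y] by (simp add: space_prob_algebra)
        show "ennreal (measure (\<kappa> y) B) * indicator A y = emeasure (\<kappa> y) B * indicator A y"
          by (simp add: k.emeasure_eq_measure)
      qed
      also have "\<dots> = emeasure \<mu> {\<omega> \<in> space \<mu>. ?g \<omega> \<in> A \<and> snd \<omega> \<in> B}" by (rule int[OF A B])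
      finally have "(\<integral>\<omega>\<in>C. measure (\<kappa> (?g \<omega>)) B \<partial>\<mu>) = \<mu>.prob {\<omega> \<in> space \<mu>. ?g \<omega> \<in> A \<and> snd \<omega> \<in> B}"
        by (simp add: measure_def)
      moreover have "(\<integral>\<omega>\<in>C. (indicator B (snd \<omega>) :: real) \<partial>\<mu>)
          = (\<integral>\<omega>. indicator {\<omega> \<in> space \<mu>. ?g \<omega> \<in> A \<and> snd \<omega> \<in> B} \<omega> \<partial>\<mu>)"
        unfolding set_lebesgue_integral_def
        by (rule Bochner_Integration.integral_cong) (auto simp: C indicator_def)
      moreover have "\<dots> = \<mu>.prob {\<omega> \<in> space \<mu>. ?g \<omega> \<in> A \<and> snd \<omega> \<in> B}"
        by (auto intro!: arg_cong[where f = \<mu>.prob])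
      ultimately show "(\<integral>\<omega>\<in>C. indicator B (snd \<omega>) \<partial>\<mu>) = (\<integral>\<omega>\<in>C. measure (\<kappa> (?g \<omega>)) B \<partial>\<mu>)"
        by simp
    qed
    then have "\<forall>B\<in>sets (borel_on \<Theta>). AE \<omega> in \<mu>. measure (\<kappa> (?g \<omega>)) B =
        real_cond_exp \<mu> (F n) (\<lambda>\<omega>. indicator B (snd \<omega>)) \<omega>"
      by (auto simp: eq_commute)
    with \<kappa> show ?thesis by blast
  qed
  then have "\<forall>n. \<exists>\<kappa>. \<kappa> \<in> (\<Pi>\<^sub>M i\<in>{..<n}. borel_on X) \<rightarrow>\<^sub>M prob_algebra (borel_on \<Theta>) \<and>
      (\<forall>B\<in>sets (borel_on \<Theta>). AE \<omega> in \<mu>. measure (\<kappa> (first_obs n (fst \<omega>))) B =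
        real_cond_exp \<mu> (F n) (\<lambda>\<omega>. indicator B (snd \<omega>)) \<omega>)" by blast
  from choice[OF this] show ?thesis unfolding is_posterior_def .
qed

lemma posterior_converges:
  assumes inj: "\<And>\<theta> \<theta>'. \<theta> \<in> \<Theta> \<Longrightarrow> \<theta>' \<in> \<Theta> \<Longrightarrow> \<theta> \<noteq> \<theta>' \<Longrightarrow> P \<theta> \<noteq> P \<theta>'"
    and post: "is_posterior X \<Theta> P prior post" and B[measurable]: "B \<in> sets (borel_on \<Theta>)"
  shows "AE \<omega> in \<mu>. (\<lambda>n. measure (post n (first_obs n (fst \<omega>))) B) \<longlonglongrightarrow> indicator B (snd \<omega>)"
proof -
  define E where "E = {\<omega> \<in> space \<mu>. snd \<omega> \<in> B}"
  have [measurable]: "E \<in> sets \<mu>" unfolding E_def by measurable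
  have "AE \<omega> in \<mu>. (\<lambda>n. real_cond_exp \<mu> (F n) (indicator E) \<omega>) \<longlonglongrightarrow> indicator E \<omega>"
    unfolding E_def by (rule \<mu>.levy_zero_one[OF subalgebra_F sets_F_mono parameter_limit_event[OF inj B]])
  moreover have "AE \<omega> in \<mu>. \<forall>n. measure (post n (first_obs n (fst \<omega>))) B = real_cond_exp \<mu> (F n) (indicator E) \<omega>"
    unfolding AE_all_countable
  proof
    fix n
    interpret G: finite_measure_subalgebra \<mu> "F n" by (rule finite_subalgebra_F)
    have "AE \<omega> in \<mu>. real_cond_exp \<mu> (F n) (\<lambda>\<omega>. indicator B (snd \<omega>)) \<omega> = real_cond_exp \<mu> (F n) (indicator E) \<omega>"
      by (rule G.real_cond_exp_cong) (auto intro!: AE_I2 simp: E_def indicator_def)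
    moreover have "AE \<omega> in \<mu>. measure (post n (first_obs n (fst \<omega>))) B =
        real_cond_exp \<mu> (F n) (\<lambda>\<omega>. indicator B (snd \<omega>)) \<omega>"
      using post B unfolding is_posterior_def by blast
    ultimately show "AE \<omega> in \<mu>. measure (post n (first_obs n (fst \<omega>))) B = real_cond_exp \<mu> (F n) (indicator E) \<omega>"
      by eventually_elim simp
  qed
  ultimately show ?thesis using AE_space
    by eventually_elim (simp add: E_def indicator_def)
qed

text \<open>
  A single null set has to serve all neighborhoods of all parameters. It is found for the countably
  many base sets; regularity of the posterior then gives the monotonicity that passes from a base set
  to a larger neighborhood outside that null set.
\<close>
theorem posterior_consistent:
  assumes inj: "\<And>\<theta> \<theta>'. \<theta> \<in> \<Theta> \<Longrightarrow> \<theta>' \<in> \<Theta> \<Longrightarrow> \<theta> \<noteq> \<theta>' \<Longrightarrow> P \<theta> \<noteq> P \<theta>'"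
    and post: "is_posterior X \<Theta> P prior post"
  shows "\<exists>\<Theta>\<^sub>1. \<Theta>\<^sub>1 \<subseteq> \<Theta> \<and> \<Theta>\<^sub>1 \<in> sets prior \<and> measure prior \<Theta>\<^sub>1 = 1 \<and>
    (\<forall>\<theta>\<^sub>1\<in>\<Theta>\<^sub>1. consistent_at \<Theta> P post \<theta>\<^sub>1)"
proof -
  obtain \<B> :: "'b set set" where \<B>: "countable \<B>" "topological_basis \<B>"
    using ex_countable_basis by blast
  have \<B>\<Theta>: "V \<inter> \<Theta> \<in> sets (borel_on \<Theta>)" if "V \<in> \<B>" for V
    using topological_basis_open[OF \<B>(2) that] \<Theta>_borel by (auto simp: sets_restrict_space_iff)
  define good where "good x \<theta> \<longleftrightarrow>
    (\<forall>V\<in>\<B>. (\<lambda>n. measure (post n (first_obs n x)) (V \<inter> \<Theta>)) \<longlonglongrightarrow> indicator (V \<inter> \<Theta>) \<theta>)" for x \<theta>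
  have "AE \<omega> in \<mu>. good (fst \<omega>) (snd \<omega>)"
    unfolding good_def AE_ball_countable[OF \<B>(1)]
    by (intro ballI posterior_converges[OF inj post \<B>\<Theta>])
  from AE_section[OF this] have "AE \<theta> in prior. AE x in iid \<theta>. good x \<theta>" by simp
  then obtain N where N: "{\<theta> \<in> space prior. \<not> (AE x in iid \<theta>. good x \<theta>)} \<subseteq> N"
    "emeasure prior N = 0" "N \<in> sets prior" by (rule AE_E)
  define \<Theta>\<^sub>1 where "\<Theta>\<^sub>1 = space prior - N"
  have "prior.prob \<Theta>\<^sub>1 = 1"
    unfolding \<Theta>\<^sub>1_def using prior.prob_compl[OF N(3)] N(2) by (simp add: measure_def)
  moreover have "consistent_at \<Theta> P post \<theta>" if "\<theta> \<in> \<Theta>\<^sub>1" for \<theta>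
    unfolding consistent_at_def
  proof (intro ballI impI)
    fix B assume B: "B \<in> sets (borel_on \<Theta>)" and "\<theta> \<in> top_of_set \<Theta> interior_of B"
    then obtain T where "openin (top_of_set \<Theta>) T" "\<theta> \<in> T" "T \<subseteq> B" by (auto simp: interior_of_def)
    then obtain U where U: "open U" "\<theta> \<in> U" "\<theta> \<in> \<Theta>" "\<Theta> \<inter> U \<subseteq> B" by (auto simp: openin_open)
    then obtain V where V: "V \<in> \<B>" "\<theta> \<in> V" "V \<subseteq> U" using topological_basisE[OF \<B>(2)] by metis
    have "AE x in iid \<theta>. good x \<theta>" using that N(1) by (auto simp: \<Theta>\<^sub>1_def)
    then show "AE x in iid \<theta>. (\<lambda>n. measure (post n (first_obs n x)) B) \<longlonglongrightarrow> 1"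
      using AE_space
    proof eventually_elim
      case (elim x)
      have pn: "prob_space (post n (first_obs n x))" "sets (post n (first_obs n x)) = sets (borel_on \<Theta>)" for n
      proof -
        have "first_obs n x \<in> space (\<Pi>\<^sub>M i\<in>{..<n}. borel_on X)"
          using elim(2) unfolding space_iid[OF U(3)] by (auto simp: space_PiM first_obs_def)
        moreover have "post n \<in> (\<Pi>\<^sub>M i\<in>{..<n}. borel_on X) \<rightarrow>\<^sub>M prob_algebra (borel_on \<Theta>)"
          using post by (simp add: is_posterior_def)
        ultimately have "post n (first_obs n x) \<in> space (prob_algebra (borel_on \<Theta>))"
          by (rule measurable_space[rotated])
        then show "prob_space (post n (first_obs n x))" "sets (post n (first_obs n x)) = sets (borel_on \<Theta>)"
          by (auto simp: space_prob_algebra)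
      qed
      have lower: "(\<lambda>n. measure (post n (first_obs n x)) (V \<inter> \<Theta>)) \<longlonglongrightarrow> 1"
        using elim(1) V U(3) by (auto simp: good_def indicator_def dest!: bspec[of _ _ V])
      show ?case
      proof (rule tendsto_sandwich[OF _ _ lower tendsto_const])
        show "\<forall>\<^sub>F n in sequentially. measure (post n (first_obs n x)) (V \<inter> \<Theta>) \<le> measure (post n (first_obs n x)) B"
        proof (intro always_eventually allI)
          fix n
          interpret p: prob_space "post n (first_obs n x)" by (rule pn)
          show "measure (post n (first_obs n x)) (V \<inter> \<Theta>) \<le> measure (post n (first_obs n x)) B"
            by (rule p.finite_measure_mono) (use V U B pn(2) in auto)
        qed
        show "\<forall>\<^sub>F n in sequentially. measure (post n (first_obs n x)) B \<le> 1"
          by (intro always_eventually allI prob_space.prob_le_1 pn)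
      qed
    qed
  qed
  moreover have "\<Theta>\<^sub>1 \<in> sets prior" unfolding \<Theta>\<^sub>1_def by (rule sets.compl_sets[OF N(3)])
  moreover have "\<Theta>\<^sub>1 \<subseteq> \<Theta>" by (auto simp: \<Theta>\<^sub>1_def space_prior)
  ultimately show ?thesis by blast
qed

end

theorem theorem2p4:
  fixes X :: "'a::polish_space set" and \<Theta> :: "'b::polish_space set"
    and P :: "'b \<Rightarrow> 'a measure" and prior :: "'b measure"
  assumes "X \<in> sets borel" and "\<Theta> \<in> sets borel"
    and "\<And>\<theta>. \<theta> \<in> \<Theta> \<Longrightarrow> prob_space (P \<theta>)"
    and "\<And>\<theta>. \<theta> \<in> \<Theta> \<Longrightarrow> sets (P \<theta>) = sets (borel_on X)"
    and "prob_space prior" and "sets prior = sets (borel_on \<Theta>)"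
    and "\<And>A. A \<in> sets (borel_on X) \<Longrightarrow>
           (\<lambda>\<theta>. measure (P \<theta>) A) \<in> borel_measurable (borel_on \<Theta>)"
    and "\<And>\<theta> \<theta>'. \<theta> \<in> \<Theta> \<Longrightarrow> \<theta>' \<in> \<Theta> \<Longrightarrow> \<theta> \<noteq> \<theta>' \<Longrightarrow> P \<theta> \<noteq> P \<theta>'"
  shows "(\<exists>post. is_posterior X \<Theta> P prior post) \<and>
    (\<forall>post. is_posterior X \<Theta> P prior post \<longrightarrow>
      (\<exists>\<Theta>\<^sub>1. \<Theta>\<^sub>1 \<subseteq> \<Theta> \<and> \<Theta>\<^sub>1 \<in> sets prior \<and> measure prior \<Theta>\<^sub>1 = 1 \<and>
        (\<forall>\<theta>\<^sub>1\<in>\<Theta>\<^sub>1. consistent_at \<Theta> P post \<theta>\<^sub>1)))"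
proof -
  interpret iid_model X \<Theta> P prior by (rule iid_model.intro) (fact assms)+
  show ?thesis using posterior_exists posterior_consistent[OF assms(8)] by blast
qed

end
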